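(* Let $M\in M(2n-1,\mathbb R)$ be such that $M=M(a)\oplus Q$, where $a\in\mathbb R$, $M(a)\in M(m_a,\mathbb R)$ has $a$ as its only eigenvalue, $m_a$ is odd, $Q\in M(m,\mathbb R)$ with $m=2n-1-m_a\geq 1$, and $a\notin\mathrm{spec}(Q)$. Then $\mathfrak g_M$ admits a complex structure if and only if $\Lambda(M(a))\in\bigwedge^c_{m_a}$ and $Q\in M_{J'}(m,\mathbb R)$ for some $J'\in M(m,\mathbb R)$ such that $(J')^2=-I_m$.
   Context: For $A\in M(d,\mathbb R)$, $\mathfrak g_A=\mathbb R e_0\ltimes_A\mathbb R^d$ denotes the $(d+1)$-dimensional real Lie algebra $\mathbb R e_0\oplus\mathbb R^d$ with $[e_0,v]=Av$ and $[v,w]=0$ for $v,w\in\mathbb R^d$. A complex structure on a real Lie algebra $\mathfrak g$ is a linear automorphism $j$ of the vector space $\mathfrak g$ with $j^2=-\mathrm{id}$ and $[x,y]+j([jx,y]+[x,jy])-[jx,jy]=0$ for all $x,y\in\mathfrak g$. $\mathrm{spec}(C)$ is the set of distinct complex eigenvalues of $C$; $\oplus$ is block-diagonal sum, $N^{\oplus p}$ the block-diagonal sum of $p$ copies of $N$; $I_t$ is the $t\times t$ identity matrix. For $J\in M(m,\mathbb R)$ with $J^2=-I_m$, $M_J(m,\mathbb R)=\{B\in M(m,\mathbb R): BJ=JB\}$. $\mathcal J_n(b)$ ($n\ge2$) is the $n\times n$ Jordan block with $b$ on the diagonal, ones on the subdiagonal and zeros elsewhere. Let $\bigwedge_m$ be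 the set consisting of the symbol $(m)$ and all tuples of integers $(n_1,\ldots,n_k;p_1,\ldots,p_k;t)$ with $k\ge1$, $n_1>\cdots>n_k\ge2$, all $p_i>0$, $t\ge0$ and $\sum_i n_ip_i+t=m$. For a matrix $A\in M(m,\mathbb R)$ whose only eigenvalue is $b\in\mathbb R$: $\Lambda(A)=(m)$ if $A=bI_m$, and $\Lambda(A)=(n_1,\ldots,n_k;p_1,\ldots,p_k;t)$ if $A$ is conjugate to $\mathcal J_{n_1}(b)^{\oplus p_1}\oplus\cdots\oplus\mathcal J_{n_k}(b)^{\oplus p_k}\oplus bI_t$. For odd $m$, $\bigwedge^c_m\subset\bigwedge_m$ consists of $(m)$ together with all tuples $(n_1,\ldots,n_k;p_1,\ldots,p_k;t)\in\bigwedge_m$ satisfying one of: (i) $t$ is odd and all $p_i$ are even; (ii) $t$ is odd, $p_i$ is even for all $i\le k-1$, $n_k=2$ and $p_k$ is odd; (iii) $t$ is even, $k\ge2$, and there is $2\le\ell\le k$ with $n_{\ell-1}=n_\ell+1$, $p_{\ell-1}$ and $p_\ell$ odd, and $p_i$ even for all $i\notin\{\ell-1,\ell\}$. *)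

theory Defs
  imports "Jordan_Normal_Form.Spectral_Radius"
begin

section \<open>Semidirect products with the line, and complex structures\<close>

text \<open>
  A finite-dimensional real Lie algebra is presented by a bracket on the coordinate space
  \<open>carrier_vec N\<close>.
\<close>

definition lie_bracket :: "nat \<Rightarrow> (real vec \<Rightarrow> real vec \<Rightarrow> real vec) \<Rightarrow> bool" where
  "lie_bracket N br \<longleftrightarrow>
     (\<forall>x \<in> carrier_vec N. \<forall>y \<in> carrier_vec N. br x y \<in> carrier_vec N) \<and>
     (\<forall>x \<in> carrier_vec N. \<forall>y \<in> carrier_vec N. \<forall>z \<in> carrier_vec N. \<forall>c.
        br (x + y) z = br x z + br y z \<and> br z (x + y) = br z x + br z y \<and>
        br (c \<cdot>\<^sub>v x) y = c \<cdot>\<^sub>v br x y \<and> br x (c \<cdot>\<^sub>v y) = c \<cdot>\<^sub>v br x y) \<and>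
     (\<forall>x \<in> carrier_vec N. br x x = 0\<^sub>v N) \<and>
     (\<forall>x \<in> carrier_vec N. \<forall>y \<in> carrier_vec N. \<forall>z \<in> carrier_vec N.
        br x (br y z) + br y (br z x) + br z (br x y) = 0\<^sub>v N)"

definition complex_structure ::
  "nat \<Rightarrow> (real vec \<Rightarrow> real vec \<Rightarrow> real vec) \<Rightarrow> (real vec \<Rightarrow> real vec) \<Rightarrow> bool" where
  "complex_structure N br j \<longleftrightarrow>
     bij_betw j (carrier_vec N) (carrier_vec N) \<and>
     (\<forall>x \<in> carrier_vec N. \<forall>y \<in> carrier_vec N. j (x + y) = j x + j y) \<and>
     (\<forall>c. \<forall>x \<in> carrier_vec N. j (c \<cdot>\<^sub>v x) = c \<cdot>\<^sub>v j x) \<and>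
     (\<forall>x \<in> carrier_vec N. j (j x) = - x) \<and>
     (\<forall>x \<in> carrier_vec N. \<forall>y \<in> carrier_vec N.
        br x y + j (br (j x) y + br x (j y)) - br (j x) (j y) = 0\<^sub>v N)"

definition admits_complex_structure :: "nat \<Rightarrow> (real vec \<Rightarrow> real vec \<Rightarrow> real vec) \<Rightarrow> bool" where
  "admits_complex_structure N br \<longleftrightarrow> (\<exists>j. complex_structure N br j)"

text \<open>
  For a square matrix \<open>A\<close> of size \<open>d\<close>, the space \<open>\<real>e\<^sub>0 \<oplus> \<real>\<^sup>d\<close> is identified with
  \<open>carrier_vec (d + 1)\<close>, the element \<open>s e\<^sub>0 + v\<close> being \<open>vCons s v\<close>.  The bilinear antisymmetric
  extension of \<open>[e\<^sub>0, v] = A v\<close>, \<open>[v, w] = 0\<close> is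
  \<open>[s e\<^sub>0 + v, t e\<^sub>0 + w] = s A w - t A v\<close>.
\<close>

definition semidirect_bracket :: "real mat \<Rightarrow> real vec \<Rightarrow> real vec \<Rightarrow> real vec" where
  "semidirect_bracket A x y =
     vCons 0 (x $ 0 \<cdot>\<^sub>v (A *\<^sub>v vec_last y (dim_row A))
            - y $ 0 \<cdot>\<^sub>v (A *\<^sub>v vec_last x (dim_row A)))"

lemma vec_last_vCons:
  assumes "v \<in> carrier_vec d"
  shows "vec_last (vCons s v) d = v"
  using assms by (intro eq_vecI) (auto simp: vec_last_def)

lemma semidirect_bracket_vCons:
  assumes "A \<in> carrier_mat d d" "v \<in> carrier_vec d" "w \<in> carrier_vec d"
  shows "semidirect_bracket A (vCons s v) (vCons t w) =
           vCons 0 (s \<cdot>\<^sub>v (A *\<^sub>v w) - t \<cdot>\<^sub>v (A *\<^sub>v v))"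
  using assms by (simp add: semidirect_bracket_def vec_last_vCons)

lemma semidirect_bracket_e0:
  assumes "A \<in> carrier_mat d d" "v \<in> carrier_vec d"
  shows "semidirect_bracket A (unit_vec (d + 1) 0) (vCons 0 v) = vCons 0 (A *\<^sub>v v)"
proof -
  have "unit_vec (d + 1) 0 = vCons (1 :: real) (0\<^sub>v d)"
    by (intro eq_vecI) (auto simp: vCons_def unit_vec_def split: nat.split)
  moreover have "A *\<^sub>v v \<in> carrier_vec d"
    using assms by simp
  ultimately show ?thesis
    using assms by (simp add: semidirect_bracket_vCons) (auto intro!: eq_vecI)
qed

lemma semidirect_bracket_abelian:
  assumes "A \<in> carrier_mat d d" "v \<in> carrier_vec d" "w \<in> carrier_vec d"
  shows "semidirect_bracket A (vCons 0 v) (vCons 0 w) = 0\<^sub>v (d + 1)"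
  using assms
  by (simp add: semidirect_bracket_vCons) (auto intro!: eq_vecI simp: vCons_def split: nat.split)

lemma lie_bracket_semidirect_bracket:
  assumes A: "A \<in> carrier_mat d d"
  shows "lie_bracket (d + 1) (semidirect_bracket A)"
proof -
  let ?br = "semidirect_bracket A"
  let ?V = "carrier_vec (d + 1) :: real vec set"
  have dim: "dim_row A = d" "dim_col A = d"
    using A by auto
  have last_add: "vec_last (x + y) d = vec_last x d + vec_last y d" if "x \<in> ?V" "y \<in> ?V" for x y
    using that by (intro eq_vecI) (auto simp: vec_last_def)
  have last_smult: "vec_last (c \<cdot>\<^sub>v x) d = c \<cdot>\<^sub>v vec_last x d" if "x \<in> ?V" for c x
    using that by (intro eq_vecI) (auto simp: vec_last_def)
  have mult_add: "A *\<^sub>v (v + w) = A *\<^sub>v v + A *\<^sub>v w"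
    if "v \<in> carrier_vec d" "w \<in> carrier_vec d" for v w
    using A that by (rule mult_add_distrib_mat_vec)
  have mult_smult: "A *\<^sub>v (c \<cdot>\<^sub>v v) = c \<cdot>\<^sub>v (A *\<^sub>v v)" if "v \<in> carrier_vec d" for c v
    using A that by (rule mult_mat_vec)
  have dim_br: "dim_vec (?br x y) = d + 1" for x y
    using A by (auto simp: semidirect_bracket_def)
  have nth0: "?br x y $ 0 = 0" for x y
    by (simp add: semidirect_bracket_def)
  have nthS: "?br x y $ Suc i = x $ 0 * (A *\<^sub>v vec_last y d) $ i - y $ 0 * (A *\<^sub>v vec_last x d) $ i"
    if "i < d" for x y i
    using A that by (simp add: semidirect_bracket_def del: index_mult_mat_vec)
  have eqI: "u = v" if "dim_vec u = d + 1" "dim_vec v = d + 1" "u $ 0 = v $ 0"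
    "\<And>i. i < d \<Longrightarrow> u $ Suc i = v $ Suc i" for u v :: "real vec"
  proof (rule eq_vecI)
    fix i assume "i < dim_vec v"
    then show "u $ i = v $ i"
      using that by (cases i) auto
  qed (use that in simp)
  have last_br: "vec_last (?br x y) d =
      x $ 0 \<cdot>\<^sub>v (A *\<^sub>v vec_last y d) + (- y $ 0) \<cdot>\<^sub>v (A *\<^sub>v vec_last x d)" for x y
    by (intro eq_vecI) (auto simp: vec_last_def[of "?br x y"] dim_br nthS dim simp del: index_mult_mat_vec)
  have cl: "A *\<^sub>v vec_last x d \<in> carrier_vec d" for x
    using A by simp
  have br_cl: "?br x y \<in> ?V" for x y
    using dim_br by (auto intro: carrier_vecI)
  have add: "?br (x + y) z = ?br x z + ?br y z" "?br z (x + y) = ?br z x + ?br z y"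
    if "x \<in> ?V" "y \<in> ?V" "z \<in> ?V" for x y z
    using that by (auto intro!: eqI simp: dim_br nth0 nthS last_add mult_add dim ring_distribs
        simp del: index_mult_mat_vec)
  have smult: "?br (c \<cdot>\<^sub>v x) y = c \<cdot>\<^sub>v ?br x y" "?br x (c \<cdot>\<^sub>v y) = c \<cdot>\<^sub>v ?br x y"
    if "x \<in> ?V" "y \<in> ?V" for c x y
    using that by (auto intro!: eqI simp: dim_br nth0 nthS last_smult mult_smult dim right_diff_distrib
        simp del: index_mult_mat_vec)
  have self: "?br x x = 0\<^sub>v (d + 1)" for x
    by (auto intro!: eqI simp: dim_br nth0 nthS)
  have cyclic: "p * (q * u - r * v) + q * (r * w - p * u) + r * (p * v - q * w) = 0"
    for p q r u v w :: real
    by (simp add: algebra_simps)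
  have jacobi: "?br x (?br y z) + ?br y (?br z x) + ?br z (?br x y) = 0\<^sub>v (d + 1)" for x y z
    by (rule eqI)
      (simp_all add: dim_br nth0 nthS last_br mult_add mult_smult cl dim cyclic
        del: index_mult_mat_vec)
  show ?thesis
    unfolding lie_bracket_def by (intro conjI ballI allI br_cl add smult self jacobi)
qed


section \<open>Spectrum and commutant\<close>

definition spec :: "real mat \<Rightarrow> complex set" where
  "spec C = spectrum (map_mat complex_of_real C)"

definition commutant :: "real mat \<Rightarrow> nat \<Rightarrow> real mat set" where
  "commutant J m = {B \<in> carrier_mat m m. B * J = J * B}"


section \<open>Jordan types\<close>

text \<open>
  The blocks have their ones below the diagonal, unlike those of \<open>jordan_block\<close> in the library.
\<close>

definition lower_jordan_block :: "nat \<Rightarrow> real \<Rightarrow> real mat" where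
  "lower_jordan_block n b = mat n n (\<lambda>(i, j). if i = j then b else if i = j + 1 then 1 else 0)"

text \<open>
  \<open>Scalar_Type m\<close> is the symbol \<open>(m)\<close>; \<open>Block_Type ns ps t\<close> is the tuple
  \<open>(n\<^sub>1, \<dots>, n\<^sub>k; p\<^sub>1, \<dots>, p\<^sub>k; t)\<close>, with \<open>n\<^sub>i = ns ! (i - 1)\<close> and \<open>p\<^sub>i = ps ! (i - 1)\<close>.
\<close>

datatype jordan_type = Scalar_Type nat | Block_Type "nat list" "nat list" nat

fun is_jordan_type :: "nat \<Rightarrow> jordan_type \<Rightarrow> bool" where
  "is_jordan_type m (Scalar_Type l) \<longleftrightarrow> l = m"
| "is_jordan_type m (Block_Type ns ps t) \<longleftrightarrow>
     length ns \<ge> 1 \<and> length ps = length ns \<and> sorted_wrt (>) ns \<and>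
     (\<forall>n \<in> set ns. n \<ge> 2) \<and> (\<forall>p \<in> set ps. p > 0) \<and>
     (\<Sum>i < length ns. ns ! i * ps ! i) + t = m"

definition jordan_types :: "nat \<Rightarrow> jordan_type set" where
  "jordan_types m = {l. is_jordan_type m l}"

fun has_jordan_type :: "real mat \<Rightarrow> real \<Rightarrow> jordan_type \<Rightarrow> bool" where
  "has_jordan_type A b (Scalar_Type l) \<longleftrightarrow> A = b \<cdot>\<^sub>m 1\<^sub>m l"
| "has_jordan_type A b (Block_Type ns ps t) \<longleftrightarrow>
     similar_mat A
       (diag_block_mat
         (concat (map2 (\<lambda>n p. replicate p (lower_jordan_block n b)) ns ps) @ [b \<cdot>\<^sub>m 1\<^sub>m t]))"

text \<open>
  Meaningful for a square matrix with a single, real, eigenvalue; such a matrix has exactly one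
  type, by existence and uniqueness of the Jordan normal form.
\<close>

definition jordan_type_of :: "real mat \<Rightarrow> jordan_type" where
  "jordan_type_of A =
     (SOME l. l \<in> jordan_types (dim_row A) \<and>
              (\<exists>b. spec A = {complex_of_real b} \<and> has_jordan_type A b l))"

text \<open>
  Only used for odd \<open>m\<close>.  List positions start at \<open>0\<close>, so the last block size \<open>n\<^sub>k\<close> is
  \<open>ns ! (k - 1)\<close>, and the index \<open>l\<close> below is one less than the corresponding \<open>\<ell>\<close>
  of the usual numbering \<open>2 \<le> \<ell> \<le> k\<close>.
\<close>

fun is_complex_type :: "jordan_type \<Rightarrow> bool" where
  "is_complex_type (Scalar_Type m) \<longleftrightarrow> True"
| "is_complex_type (Block_Type ns ps t) \<longleftrightarrow>
     (let k = length ns in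
       (odd t \<and> (\<forall>i < k. even (ps ! i))) \<or>
       (odd t \<and> (\<forall>i < k - 1. even (ps ! i)) \<and> ns ! (k - 1) = 2 \<and> odd (ps ! (k - 1))) \<or>
       (even t \<and> k \<ge> 2 \<and>
         (\<exists>l. 1 \<le> l \<and> l < k \<and> ns ! (l - 1) = ns ! l + 1 \<and>
              odd (ps ! (l - 1)) \<and> odd (ps ! l) \<and>
              (\<forall>i < k. i \<notin> {l - 1, l} \<longrightarrow> even (ps ! i)))))"

definition complex_jordan_types :: "nat \<Rightarrow> jordan_type set" where
  "complex_jordan_types m = {l \<in> jordan_types m. is_complex_type l}"

end

theory Submission
  imports Defs "Jordan_Normal_Form.Jordan_Normal_Form_Uniqueness"
begin

text \<open>
  A complex structure on \<open>\<real>e\<^sub>0 \<ltimes>\<^sub>M V\<close> amounts to an \<open>M\<close>-invariant hyperplane \<open>W \<subseteq> V\<close> with a complex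
  structure \<open>J\<close> on \<open>W\<close> that commutes with the restriction of \<open>M\<close>: \<open>W\<close> is \<open>V \<inter> j V\<close>, and conversely
  \<open>e\<^sub>0\<close> is paired with any vector of \<open>V\<close> outside \<open>W\<close>.  As \<open>J\<close> preserves the kernels of polynomials in
  the restriction, these have even dimension.  The generalized eigenspace of the eigenvalue \<open>a\<close> has
  odd dimension, so it is not contained in \<open>W\<close>, which therefore contains the complementary
  summand; \<open>J\<close> restricts to it and gives \<open>J'\<close>.  On the generalized eigenspace, the numbers
  \<open>dim ker (M - a)\<^sup>i\<close> exceed even numbers by \<open>0\<close> for \<open>i < r\<close> and by \<open>1\<close> for \<open>i \<ge> r\<close>.  The number of Jordan
  blocks of size \<open>i\<close> is a second difference of this sequence, hence odd exactly for \<open>i = r\<close> and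
  \<open>i = r - 1 \<ge> 1\<close>; the cases \<open>r = 1\<close>, \<open>r = 2\<close>, \<open>r \<ge> 3\<close> are the three families of complex types.
  Conversely, shortening a block of size \<open>r\<close> by one leaves all block sizes with even
  multiplicity, and two equal blocks \<open>N \<oplus> N\<close> carry the complex structure \<open>(x, y) \<mapsto> (- y, x)\<close>.
\<close>

section \<open>Vectors and matrices\<close>

text \<open>Integrability of a given \<open>j\<close> is evaluated only at pairs (e_0, w) with w in
  W. Let s be the e_0-coefficient of j e_0, which need not vanish. The e_0-component of the identity
  gives the invariance of W and its V-component gives the commutation of J with M; both times an
  obstruction turns out to be annihilated by s^2 + 1, which has no real zero. Conversely, M may map
  the vector paired with e_0 anywhere: its image enters [x, y] and [jx, jy] with the same
  coefficient and cancels. This is why the first column of a bordered matrix is unrestricted.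

  The threshold r comes from vectors outside W: the dimension of ker (M - a)^i is odd exactly if
  this kernel is not contained in W, and a vector outside W stays in the kernels of all higher
  powers. Such a vector also forces M to act by a on the quotient V/W.

  Subspaces are represented by matrices throughout: a hyperplane by a basis adapted to it, any other
  subspace by an injective matrix whose columns span it.\<close>

lemma mat_eq_by_mult_vec:
  fixes A B :: "'a :: semiring_1 mat"
  assumes "A \<in> carrier_mat n m" "B \<in> carrier_mat n m"
    and "\<And>x. x \<in> carrier_vec m \<Longrightarrow> A *\<^sub>v x = B *\<^sub>v x"
  shows "A = B"
proof (rule eq_matI)
  fix i j assume "i < dim_row B" "j < dim_col B"
  with assms(1,2) have ij: "i < n" "j < m" by auto
  have "(A *\<^sub>v unit_vec m j) $ i = (B *\<^sub>v unit_vec m j) $ i"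
    using assms(3)[of "unit_vec m j"] by simp
  with assms(1,2) ij show "A $$ (i, j) = B $$ (i, j)" by simp
qed (use assms(1,2) in auto)

lemma smult_minus_one_vec [simp]: "(- 1) \<cdot>\<^sub>v x = - (x :: 'a :: comm_ring_1 vec)"
  by (intro eq_vecI) auto

lemma zero_smult_vec [simp]: "0 \<cdot>\<^sub>v x = (0\<^sub>v (dim_vec x) :: 'a :: semiring_1 vec)"
  by (intro eq_vecI) auto

lemma smult_zero_vec [simp]: "c \<cdot>\<^sub>v 0\<^sub>v n = (0\<^sub>v n :: 'a :: semiring_1 vec)"
  by (intro eq_vecI) auto

lemma mult_mat_zero_vec [simp]:
  "dim_col A = n \<Longrightarrow> A *\<^sub>v 0\<^sub>v n = (0\<^sub>v (dim_row A) :: 'a :: semiring_1 vec)"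
  by (intro eq_vecI) auto

lemma zero_mat_mult_vec [simp]:
  "dim_vec x = m \<Longrightarrow> 0\<^sub>m n m *\<^sub>v x = (0\<^sub>v n :: 'a :: semiring_1 vec)"
  by (intro eq_vecI) auto

lemma uminus_zero_mat [simp]: "- 0\<^sub>m n m = (0\<^sub>m n m :: 'a :: ring_1 mat)"
  by (intro eq_matI) auto

lemma mult_mat_uminus_vec:
  fixes A :: "'a :: field mat"
  shows "A \<in> carrier_mat n m \<Longrightarrow> v \<in> carrier_vec m \<Longrightarrow> A *\<^sub>v (- v) = - (A *\<^sub>v v)"
  using mult_mat_vec[of A n m v "- 1"] by simp

lemma uminus_mult_one_mat_vec:
  "v \<in> carrier_vec n \<Longrightarrow> (- 1\<^sub>m n) *\<^sub>v v = - (v :: 'a :: comm_ring_1 vec)"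
  by (intro eq_vecI) (auto simp: scalar_prod_uminus_left)

lemma vCons_add_vCons:
  "dim_vec v = dim_vec w \<Longrightarrow> vCons a v + vCons b w = vCons (a + b) (v + w)"
  by (intro eq_vecI) (auto simp: vec_index_vCons)

lemma vCons_minus_vCons:
  "dim_vec v = dim_vec w \<Longrightarrow> vCons a v - vCons b w = vCons (a - b) (v - w)"
  by (intro eq_vecI) (auto simp: vec_index_vCons)

lemma uminus_vCons: "- vCons a v = vCons (- a) (- v)"
  by (intro eq_vecI) (auto simp: vec_index_vCons)

lemma smult_vCons: "c \<cdot>\<^sub>v vCons a v = vCons (c * a) (c \<cdot>\<^sub>v v)"
  by (intro eq_vecI) (auto simp: vec_index_vCons)

lemma carrier_vec_SucE:
  assumes "x \<in> carrier_vec (Suc n)"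
  obtains a v where "v \<in> carrier_vec n" "x = vCons a v"
  using assms by (cases x) auto

text \<open>The zero block in the upper right corner expresses that the last basis vectors span an
  invariant hyperplane. \<open>B\<close> is the restriction to it, \<open>c\<close> the action on
  the quotient line, and \<open>v\<close> the hyperplane part of the image of the first basis
  vector.\<close>

definition bordered_mat :: "real \<Rightarrow> real vec \<Rightarrow> real mat \<Rightarrow> real mat" where
  "bordered_mat c v B = four_block_mat (mat 1 1 (\<lambda>_. c)) (0\<^sub>m 1 (dim_col B))
     (mat (dim_vec v) 1 (\<lambda>(i, _). v $ i)) B"

lemma bordered_mat_carrier [simp]:
  "B \<in> carrier_mat k k \<Longrightarrow> bordered_mat c v B \<in> carrier_mat (Suc k) (Suc k)"
  unfolding bordered_mat_def by auto

lemma dim_bordered_mat [simp]: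
  "dim_row (bordered_mat c v B) = Suc (dim_row B)" "dim_col (bordered_mat c v B) = Suc (dim_col B)"
  unfolding bordered_mat_def by auto

lemma bordered_mat_mult_vCons:
  assumes "v \<in> carrier_vec k" "B \<in> carrier_mat k k" "w \<in> carrier_vec k"
  shows "bordered_mat c v B *\<^sub>v vCons x w = vCons (c * x) (x \<cdot>\<^sub>v v + B *\<^sub>v w)"
proof -
  have x: "vCons x w = vec 1 (\<lambda>_. x) @\<^sub>v w"
    by (intro eq_vecI) (auto simp: vec_index_vCons)
  have "bordered_mat c v B *\<^sub>v vCons x w =
      (mat 1 1 (\<lambda>_. c) *\<^sub>v vec 1 (\<lambda>_. x) + 0\<^sub>m 1 k *\<^sub>v w) @\<^sub>v
      (mat k 1 (\<lambda>(i, _). v $ i) *\<^sub>v vec 1 (\<lambda>_. x) + B *\<^sub>v w)"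
    unfolding x bordered_mat_def
    using assms by (subst four_block_mat_mult_vec[of _ 1 1 _ k _ k]) auto
  also have "mat 1 1 (\<lambda>_. c) *\<^sub>v vec 1 (\<lambda>_. x) + 0\<^sub>m 1 k *\<^sub>v w = vec 1 (\<lambda>_. c * x)"
    using assms by (intro eq_vecI) (auto simp: scalar_prod_def)
  also have "mat k 1 (\<lambda>(i, _). v $ i) *\<^sub>v vec 1 (\<lambda>_. x) = x \<cdot>\<^sub>v v"
    using assms by (intro eq_vecI) (auto simp: scalar_prod_def)
  also have "vec 1 (\<lambda>_. c * x) @\<^sub>v (x \<cdot>\<^sub>v v + B *\<^sub>v w) = vCons (c * x) (x \<cdot>\<^sub>v v + B *\<^sub>v w)"
    by (intro eq_vecI) (auto simp: vec_index_vCons)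
  finally show ?thesis .
qed

lemma bordered_mat_eqI:
  assumes "A \<in> carrier_mat (Suc k) (Suc k)" "v \<in> carrier_vec k" "B \<in> carrier_mat k k"
    and "\<And>x w. w \<in> carrier_vec k \<Longrightarrow> A *\<^sub>v vCons x w = vCons (c * x) (x \<cdot>\<^sub>v v + B *\<^sub>v w)"
  shows "A = bordered_mat c v B"
  using assms
  by (intro mat_eq_by_mult_vec[of _ "Suc k" "Suc k"]) 
     (auto elim!: carrier_vec_SucE simp: bordered_mat_mult_vCons)

lemma bordered_mat_if_first_row:
  assumes A: "A \<in> carrier_mat (Suc k) (Suc k)"
    and 0: "\<And>j. j < k \<Longrightarrow> A $$ (0, Suc j) = 0"
  shows "A = bordered_mat (A $$ (0, 0)) (vec k (\<lambda>i. A $$ (Suc i, 0)))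
               (mat k k (\<lambda>(i, j). A $$ (Suc i, Suc j)))"
  unfolding bordered_mat_def
proof (rule eq_matI, goal_cases)
  case (1 i j)
  with 0 show ?case by (cases i; cases j) auto
qed (use A in auto)

lemma bordered_mat_mult:
  assumes "v \<in> carrier_vec k" "B \<in> carrier_mat k k" "v' \<in> carrier_vec k" "B' \<in> carrier_mat k k"
  shows "bordered_mat c v B * bordered_mat c' v' B' = bordered_mat (c * c') (c' \<cdot>\<^sub>v v + B *\<^sub>v v') (B * B')"
proof (rule bordered_mat_eqI)
  fix x :: real and w :: "real vec" assume w: "w \<in> carrier_vec k"
  have "B *\<^sub>v (x \<cdot>\<^sub>v v' + B' *\<^sub>v w) = x \<cdot>\<^sub>v (B *\<^sub>v v') + B * B' *\<^sub>v w"
    using assms w by (simp add: mult_add_distrib_mat_vec[of _ k k] mult_mat_vec[of _ k k])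
  moreover have "c' * x \<cdot>\<^sub>v v + (x \<cdot>\<^sub>v (B *\<^sub>v v') + B * B' *\<^sub>v w) = x \<cdot>\<^sub>v (c' \<cdot>\<^sub>v v + B *\<^sub>v v') + B * B' *\<^sub>v w"
    using assms w by (intro eq_vecI) (auto simp: algebra_simps)
  ultimately show "bordered_mat c v B * bordered_mat c' v' B' *\<^sub>v vCons x w =
      vCons (c * c' * x) (x \<cdot>\<^sub>v (c' \<cdot>\<^sub>v v + B *\<^sub>v v') + B * B' *\<^sub>v w)"
    using assms w by (simp add: assoc_mult_mat_vec[of _ "Suc k" "Suc k" _ "Suc k"] bordered_mat_mult_vCons
       mult.assoc)
qed (use assms in \<open>auto intro: mult_carrier_mat[of _ _ "Suc k"]\<close>)

lemma char_matrix_bordered_mat: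
  assumes "v \<in> carrier_vec k" "B \<in> carrier_mat k k"
  shows "char_matrix (bordered_mat c v B) a = bordered_mat (c - a) v (char_matrix B a)"
  unfolding bordered_mat_def char_matrix_def using assms
  by (intro eq_matI) auto

text \<open>In a block triangular product the diagonal blocks multiply separately. The corner vector
  is left existential, since parity and kernel arguments work for any value of it.\<close>

lemma pow_bordered_mat:
  assumes "v \<in> carrier_vec k" "B \<in> carrier_mat k k"
  shows "\<exists>v' \<in> carrier_vec k. bordered_mat c v B ^\<^sub>m i = bordered_mat (c ^ i) v' (B ^\<^sub>m i)"
proof (induction i)
  case 0
  have "1\<^sub>m (Suc k) = bordered_mat 1 (0\<^sub>v k) (1\<^sub>m k)"
    by (rule bordered_mat_eqI) (auto intro!: eq_vecI simp: vec_index_vCons)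
  with assms show ?case
    by (auto intro!: bexI[of _ "0\<^sub>v k"] simp: bordered_mat_def)
next
  case (Suc i)
  then obtain v' where "v' \<in> carrier_vec k" "bordered_mat c v B ^\<^sub>m i = bordered_mat (c ^ i) v' (B ^\<^sub>m i)"
    by auto
  with assms show ?case
    by (intro bexI[of _ "c \<cdot>\<^sub>v v' + (B ^\<^sub>m i) *\<^sub>v v"]) (auto simp: bordered_mat_mult[of _ k] mult.commute
         intro!: add_carrier_vec mult_mat_vec_carrier[of _ k k] pow_carrier_mat)
qed

section \<open>Complex structures and invariant hyperplanes\<close>

text \<open>Such a \<open>J\<close> makes the real space a complex vector space on which
  \<open>B\<close> is complex linear.\<close>

definition complexifiable :: "nat \<Rightarrow> real mat \<Rightarrow> bool" where
  "complexifiable k B \<longleftrightarrow> B \<in> carrier_mat k k \<and>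
     (\<exists>J \<in> carrier_mat k k. J * J = - 1\<^sub>m k \<and> B * J = J * B)"

text \<open>
  In the basis that brings \<open>A\<close> to bordered form, the last \<open>k\<close> vectors span an invariant hyperplane,
  on which \<open>A\<close> acts as \<open>B\<close>.
\<close>

definition hyperplane_complexifiable :: "nat \<Rightarrow> real mat \<Rightarrow> bool" where
  "hyperplane_complexifiable k A \<longleftrightarrow>
     (\<exists>c. \<exists>v \<in> carrier_vec k. \<exists>B. complexifiable k B \<and> similar_mat A (bordered_mat c v B))"

lemma hyperplane_complexifiable_similar:
  "similar_mat A B \<Longrightarrow> hyperplane_complexifiable k B \<Longrightarrow> hyperplane_complexifiable k A"
  unfolding hyperplane_complexifiable_def using similar_mat_trans by blast

text \<open>Taking determinants exhibits (-1)^k as the square of a real number.\<close>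

lemma even_if_complex_structure_mat:
  fixes J :: "real mat"
  assumes J: "J \<in> carrier_mat k k" "J * J = - 1\<^sub>m k"
  shows "even k"
proof -
  have "(det J)\<^sup>2 = det (- 1\<^sub>m k :: real mat)"
    using J det_mult[of J k J] by (simp add: power2_eq_square)
  also have "- 1\<^sub>m k = (- 1 :: real) \<cdot>\<^sub>m 1\<^sub>m k"
    by (intro eq_matI) auto
  also have "det \<dots> = (- 1) ^ k" by (simp add: det_smult)
  finally have "(- 1 :: real) ^ k \<ge> 0"
    by (metis zero_le_power2)
  then show ?thesis
    by (cases "even k") auto
qed

lemma complexifiable_four_block:
  assumes "complexifiable k B" "complexifiable l C"
  shows "complexifiable (k + l) (four_block_mat B (0\<^sub>m k l) (0\<^sub>m l k) C)"
proof -
  from assms obtain J K where B: "B \<in> carrier_mat k k" "J \<in> carrier_mat k k" "J * J = - 1\<^sub>m k" "B * J = J * B"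
    and C: "C \<in> carrier_mat l l" "K \<in> carrier_mat l l" "K * K = - 1\<^sub>m l" "C * K = K * C"
    unfolding complexifiable_def by auto
  let ?J = "four_block_mat J (0\<^sub>m k l) (0\<^sub>m l k) K"
  have "?J * ?J = four_block_mat (- 1\<^sub>m k) (0\<^sub>m k l) (0\<^sub>m l k) (- 1\<^sub>m l)"
    using B C by (simp add: mult_four_block_mat[of _ k k _ l _ l _ _ k _ l])
  also have "\<dots> = - 1\<^sub>m (k + l)"
    by (intro eq_matI) auto
  finally have "?J * ?J = - 1\<^sub>m (k + l)" .
  moreover have "four_block_mat B (0\<^sub>m k l) (0\<^sub>m l k) C * ?J = ?J * four_block_mat B (0\<^sub>m k l) (0\<^sub>m l k) C"
    using B C by (simp add: mult_four_block_mat[of _ k k _ l _ l _ _ k _ l])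
  ultimately show ?thesis
    unfolding complexifiable_def using B C by (intro conjI bexI[of _ ?J]) auto
qed

lemma complexifiable_double:
  assumes B: "B \<in> carrier_mat k k"
  shows "complexifiable (k + k) (four_block_mat B (0\<^sub>m k k) (0\<^sub>m k k) B)"
proof -
  let ?J = "four_block_mat (0\<^sub>m k k) (- 1\<^sub>m k) (1\<^sub>m k) (0\<^sub>m k k) :: real mat"
  have "?J * ?J = four_block_mat (- 1\<^sub>m k) (0\<^sub>m k k) (0\<^sub>m k k) (- 1\<^sub>m k)"
    by (simp add: mult_four_block_mat[of _ k k _ k _ k _ _ k _ k])
  also have "\<dots> = - 1\<^sub>m (k + k)"
    by (intro eq_matI) auto
  finally have "?J * ?J = - 1\<^sub>m (k + k)" .
  moreover have "four_block_mat B (0\<^sub>m k k) (0\<^sub>m k k) B * ?J = ?J * four_block_mat B (0\<^sub>m k k) (0\<^sub>m k k) B"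
    using B by (simp add: mult_four_block_mat[of _ k k _ k _ k _ _ k _ k])
  ultimately show ?thesis
    unfolding complexifiable_def using B by (intro conjI bexI[of _ ?J]) auto
qed

lemma similar_mat_four_block_swap:
  fixes A B :: "'a :: comm_ring_1 mat"
  assumes "A \<in> carrier_mat k k" "B \<in> carrier_mat l l"
  shows "similar_mat (four_block_mat A (0\<^sub>m k l) (0\<^sub>m l k) B) (four_block_mat B (0\<^sub>m l k) (0\<^sub>m k l) A)"
proof -
  let ?P = "four_block_mat (0\<^sub>m k l) (1\<^sub>m k) (1\<^sub>m l) (0\<^sub>m l k) :: 'a mat"
  let ?G = "four_block_mat (0\<^sub>m l k) (1\<^sub>m l) (1\<^sub>m k) (0\<^sub>m k l) :: 'a mat"
  have P: "?P \<in> carrier_mat (k + l) (l + k)" "?G \<in> carrier_mat (l + k) (k + l)"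
    by (intro carrier_matI; simp)+
  have "?P * ?G = 1\<^sub>m (k + l)"
    by (simp add: mult_four_block_mat[of _ k l _ k _ l _ _ k _ l])
  moreover have "?G * ?P = 1\<^sub>m (l + k)"
    by (simp add: mult_four_block_mat[of _ l k _ l _ k _ _ l _ k])
  moreover have "?P * four_block_mat B (0\<^sub>m l k) (0\<^sub>m k l) A * ?G =
      four_block_mat A (0\<^sub>m k l) (0\<^sub>m l k) B"
    using assms by (simp add: mult_four_block_mat[of _ k l _ k _ l _ _ l _ k] 
       mult_four_block_mat[of _ k l _ k _ l _ _ k _ l])
  ultimately show ?thesis
    using assms P by (intro similar_matI[of _ _ ?P ?G "k + l"]) (auto simp: add.commute)
qed

text \<open>The hyperplane of the sum consists of the hyperplane of \<open>A\<close> and the whole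
  second summand, so the border column is padded with zeros.\<close>

lemma hyperplane_complexifiable_four_block:
  assumes A: "A \<in> carrier_mat (Suc k) (Suc k)" "hyperplane_complexifiable k A" and C: "complexifiable l C"
  shows "hyperplane_complexifiable (k + l) (four_block_mat A (0\<^sub>m (Suc k) l) (0\<^sub>m l (Suc k)) C)"
proof -
  from A obtain c v B where v: "v \<in> carrier_vec k" and B: "complexifiable k B"
    and AB: "similar_mat A (bordered_mat c v B)"
    unfolding hyperplane_complexifiable_def by auto
  have carr: "C \<in> carrier_mat l l" "B \<in> carrier_mat k k"
    using B C unfolding complexifiable_def by auto
  have "four_block_mat (bordered_mat c v B) (0\<^sub>m (Suc k) l) (0\<^sub>m l (Suc k)) C =
      bordered_mat c (v @\<^sub>v 0\<^sub>v l) (four_block_mat B (0\<^sub>m k l) (0\<^sub>m l k) C)"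
    unfolding bordered_mat_def using v carr by (intro eq_matI) auto
  moreover have "similar_mat (four_block_mat A (0\<^sub>m (Suc k) l) (0\<^sub>m l (Suc k)) C)
      (four_block_mat (bordered_mat c v B) (0\<^sub>m (Suc k) l) (0\<^sub>m l (Suc k)) C)"
    using AB A carr by (intro similar_mat_four_block_0_0 similar_mat_refl) auto
  ultimately show ?thesis
    unfolding hyperplane_complexifiable_def
    using v complexifiable_four_block[OF B C] by (metis append_carrier_vec zero_carrier_vec)
qed

lemma hyperplane_complexifiable_four_block':
  assumes A: "A \<in> carrier_mat (Suc k) (Suc k)" "hyperplane_complexifiable k A" and C: "complexifiable l C"
  shows "hyperplane_complexifiable (k + l) (four_block_mat C (0\<^sub>m l (Suc k)) (0\<^sub>m (Suc k) l) A)"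
  using similar_mat_four_block_swap[of C l A "Suc k"] hyperplane_complexifiable_four_block[OF assms] assms
  unfolding complexifiable_def by (auto intro: hyperplane_complexifiable_similar)

section \<open>Constructing and transporting complex structures\<close>

lemma complex_structureI:
  assumes cl: "\<And>x. x \<in> carrier_vec N \<Longrightarrow> j x \<in> carrier_vec N"
    and add: "\<And>x y. x \<in> carrier_vec N \<Longrightarrow> y \<in> carrier_vec N \<Longrightarrow> j (x + y) = j x + j y"
    and smult: "\<And>c x. x \<in> carrier_vec N \<Longrightarrow> j (c \<cdot>\<^sub>v x) = c \<cdot>\<^sub>v j x"
    and square: "\<And>x. x \<in> carrier_vec N \<Longrightarrow> j (j x) = - x"
    and integrable: "\<And>x y. x \<in> carrier_vec N \<Longrightarrow> y \<in> carrier_vec N \<Longrightarrow>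
      br x y + j (br (j x) y + br x (j y)) - br (j x) (j y) = 0\<^sub>v N"
  shows "complex_structure N br j"
proof -
  have uminus: "j (- x) = - j x" if "x \<in> carrier_vec N" for x
    using smult[OF that, of "- 1"] by simp
  have "bij_betw j (carrier_vec N) (carrier_vec N)"
    by (rule bij_betw_byWitness[where f' = "\<lambda>x. - j x"]) (auto simp: cl square uminus)
  with assms show ?thesis
    unfolding complex_structure_def by blast
qed

text \<open>The transported structure is the conjugate of \<open>j\<close> by \<open>f\<close>; its
  integrability expression is the image under \<open>f\<close> of the one for
  \<open>j\<close>.\<close>

lemma admits_complex_structure_iso:
  assumes cl: "\<And>x. x \<in> carrier_vec N \<Longrightarrow> f x \<in> carrier_vec N" "\<And>x. x \<in> carrier_vec N \<Longrightarrow> g x \<in> carrier_vec N"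
    and inv: "\<And>x. x \<in> carrier_vec N \<Longrightarrow> f (g x) = x" "\<And>x. x \<in> carrier_vec N \<Longrightarrow> g (f x) = x"
    and add: "\<And>x y. x \<in> carrier_vec N \<Longrightarrow> y \<in> carrier_vec N \<Longrightarrow> f (x + y) = f x + f y"
    and smult: "\<And>c x. x \<in> carrier_vec N \<Longrightarrow> f (c \<cdot>\<^sub>v x) = c \<cdot>\<^sub>v f x"
    and br: "\<And>x y. x \<in> carrier_vec N \<Longrightarrow> y \<in> carrier_vec N \<Longrightarrow> br' x y \<in> carrier_vec N"
    and hom: "\<And>x y. x \<in> carrier_vec N \<Longrightarrow> y \<in> carrier_vec N \<Longrightarrow> f (br' x y) = br (f x) (f y)"
    and "admits_complex_structure N br'"
  shows "admits_complex_structure N br"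
proof -
  from assms(9) obtain j where "complex_structure N br' j"
    unfolding admits_complex_structure_def by auto
  then have j_cl: "x \<in> carrier_vec N \<Longrightarrow> j x \<in> carrier_vec N"
    and j_add: "x \<in> carrier_vec N \<Longrightarrow> y \<in> carrier_vec N \<Longrightarrow> j (x + y) = j x + j y"
    and j_smult: "x \<in> carrier_vec N \<Longrightarrow> j (c \<cdot>\<^sub>v x) = c \<cdot>\<^sub>v j x"
    and j_square: "x \<in> carrier_vec N \<Longrightarrow> j (j x) = - x"
    and j_integrable: "x \<in> carrier_vec N \<Longrightarrow> y \<in> carrier_vec N \<Longrightarrow>
      br' x y + j (br' (j x) y + br' x (j y)) - br' (j x) (j y) = 0\<^sub>v N" for x y c
    unfolding complex_structure_def by (auto dest: bij_betwE)
  have g_add: "g (x + y) = g x + g y" if "x \<in> carrier_vec N" "y \<in> carrier_vec N" for x y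
    using that by (metis add add_carrier_vec cl(2) inv)
  have g_smult: "g (c \<cdot>\<^sub>v x) = c \<cdot>\<^sub>v g x" if "x \<in> carrier_vec N" for c x
    using that by (metis smult smult_carrier_vec cl(2) inv)
  have f_uminus: "f (- x) = - f x" if "x \<in> carrier_vec N" for x
    using smult[OF that, of "- 1"] by simp
  have f_minus: "f (x - y) = f x - f y" if "x \<in> carrier_vec N" "y \<in> carrier_vec N" for x y
    using that by (simp add: minus_add_uminus_vec[of _ N] add f_uminus cl)
  have f0: "f (0\<^sub>v N) = 0\<^sub>v N"
    using smult[of "0\<^sub>v N" 0] cl(1)[of "0\<^sub>v N"] by simp
  have "complex_structure N br (\<lambda>x. f (j (g x)))"
  proof (rule complex_structureI)
    fix x y :: "real vec" assume xy: "x \<in> carrier_vec N" "y \<in> carrier_vec N"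
    define x' y' where "x' = g x" and "y' = g y"
    have xy': "x' \<in> carrier_vec N" "y' \<in> carrier_vec N" "x = f x'" "y = f y'"
      using xy by (auto simp: x'_def y'_def cl inv)
    have "br x y + f (j (g (br (f (j x')) y + br x (f (j y'))))) - br (f (j x')) (f (j y')) =
       f (br' x' y' + j (br' (j x') y' + br' x' (j y')) - br' (j x') (j y'))"
      using xy' by (simp add: hom[symmetric] j_cl add[symmetric] br inv f_minus[symmetric] cl)
    then show "br x y + f (j (g (br (f (j (g x))) y + br x (f (j (g y)))))) -
        br (f (j (g x))) (f (j (g y))) = 0\<^sub>v N"
      unfolding x'_def[symmetric] y'_def[symmetric] using xy' by (simp add: j_integrable f0)
  qed (simp_all add: cl inv add g_add j_add smult g_smult j_smult j_cl j_square f_uminus)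
  then show ?thesis unfolding admits_complex_structure_def by auto
qed

lemma semidirect_bracket_carrier:
  assumes "A \<in> carrier_mat d d"
  shows "semidirect_bracket A x y \<in> carrier_vec (Suc d)"
  using assms by (auto simp: semidirect_bracket_def)

lemma admits_complex_structure_similar:
  assumes A: "A \<in> carrier_mat d d" and "similar_mat A B"
    and "admits_complex_structure (Suc d) (semidirect_bracket B)"
  shows "admits_complex_structure (Suc d) (semidirect_bracket A)"
proof -
  from assms obtain P G where "similar_mat_wit A B P G"
    unfolding similar_mat_def by auto
  note PG = similar_mat_witD2[OF A this]
  \<comment> \<open>Since A P = P B, the identity on e_0 together with \<open>P\<close> on V is a
    Lie algebra isomorphism.\<close>
  define f where "f Z x = vCons (x $ 0) (Z *\<^sub>v vec_last x d)" for Z :: "real mat" and x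
  have f_vCons: "f Z (vCons s v) = vCons s (Z *\<^sub>v v)" if "v \<in> carrier_vec d" for Z s v
    using that by (simp add: f_def vec_last_vCons)
  have GP: "G *\<^sub>v (P *\<^sub>v v) = v" "P *\<^sub>v (G *\<^sub>v v) = v" if "v \<in> carrier_vec d" for v
    using PG that by (simp_all flip: assoc_mult_mat_vec)
  show ?thesis
  proof (rule admits_complex_structure_iso[where f = "f P" and g = "f G", OF _ _ _ _ _ _ _ _ assms(3)])
    fix x y :: "real vec" assume "x \<in> carrier_vec (Suc d)" "y \<in> carrier_vec (Suc d)"
    then obtain s v t w where x: "v \<in> carrier_vec d" "x = vCons s v" and y: "w \<in> carrier_vec d" "y = vCons t w"
      by (metis carrier_vec_SucE)
    have "A *\<^sub>v (P *\<^sub>v v) = P *\<^sub>v (B *\<^sub>v v)" if "v \<in> carrier_vec d" for v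
    proof -
      have "A *\<^sub>v (P *\<^sub>v v) = P * B *\<^sub>v (G *\<^sub>v (P *\<^sub>v v))"
        unfolding PG(3) using that PG(4-) by (intro assoc_mult_mat_vec) auto
      with GP that PG show ?thesis by (simp add: assoc_mult_mat_vec[of P d d B d v])
    qed
    note AP = this
    from x y PG(4-) show "f P (semidirect_bracket B x y) = semidirect_bracket A (f P x) (f P y)"
      by (simp add: f_vCons semidirect_bracket_vCons[of _ d] AP mult_minus_distrib_mat_vec[of _ d d] mult_mat_vec[of _ d d])
  next
    fix x y :: "real vec" assume "x \<in> carrier_vec (Suc d)" "y \<in> carrier_vec (Suc d)"
    then obtain s v t w where x: "v \<in> carrier_vec d" "x = vCons s v" and y: "w \<in> carrier_vec d" "y = vCons t w"
      by (metis carrier_vec_SucE)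
    with PG show "f P (x + y) = f P x + f P y"
      by (simp add: vCons_add_vCons f_vCons mult_add_distrib_mat_vec[of _ d d])
  next
    fix c and x :: "real vec" assume "x \<in> carrier_vec (Suc d)"
    with PG show "f P (c \<cdot>\<^sub>v x) = c \<cdot>\<^sub>v f P x"
      by (auto elim!: carrier_vec_SucE simp: smult_vCons f_vCons mult_mat_vec[of _ d d])
  qed (use PG GP in \<open>auto elim!: carrier_vec_SucE simp: f_vCons semidirect_bracket_carrier\<close>)
qed

text \<open>Here j e_0 is the first basis vector of V, and j is \<open>J\<close> on the hyperplane.
  The data \<open>c\<close> and \<open>v\<close> enter a bracket only through the determinant s y -
  t x of the first two coordinates. As j rotates these coordinates, the determinant is the same for
  (X, Y) and (jX, jY), while those of (jX, Y) and (X, jY) are opposite. What remains is the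
  commutation of \<open>B\<close> with \<open>J\<close>.\<close>

lemma admits_complex_structure_bordered_mat:
  assumes v: "v \<in> carrier_vec k" and "complexifiable k B"
  shows "admits_complex_structure (Suc (Suc k)) (semidirect_bracket (bordered_mat c v B))"
proof -
  from assms obtain J where B: "B \<in> carrier_mat k k" and J: "J \<in> carrier_mat k k" and JJ: "J * J = - 1\<^sub>m k"
    and BJ: "B * J = J * B"
    unfolding complexifiable_def by auto
  define j where "j z = vCons (- z $ 1) (vCons (z $ 0) (J *\<^sub>v vec_last z k))" for z
  have last: "vec_last (vCons s (vCons x w)) k = w" if "w \<in> carrier_vec k" for s x and w :: "real vec"
    using that by (intro eq_vecI) (auto simp: vec_last_def vec_index_vCons)
  have j: "j (vCons s (vCons x w)) = vCons (- x) (vCons s (J *\<^sub>v w))" if "w \<in> carrier_vec k" for s x w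
    using that by (simp add: j_def last vec_index_vCons)
  have split: "\<exists>s x w. w \<in> carrier_vec k \<and> z = vCons s (vCons x w)" if "z \<in> carrier_vec (Suc (Suc k))" for z :: "real vec"
    using that by (metis carrier_vec_SucE)
  have JJv: "J *\<^sub>v (J *\<^sub>v w) = - w" if "w \<in> carrier_vec k" for w
    using that J by (simp add: JJ uminus_mult_one_mat_vec flip: assoc_mult_mat_vec)
  have JBv: "J *\<^sub>v (B *\<^sub>v w) = B *\<^sub>v (J *\<^sub>v w)" if "w \<in> carrier_vec k" for w
    using that J B by (simp add: BJ flip: assoc_mult_mat_vec)
  have "complex_structure (Suc (Suc k)) (semidirect_bracket (bordered_mat c v B)) j"
  proof (rule complex_structureI)
    fix X Y :: "real vec" assume "X \<in> carrier_vec (Suc (Suc k))" "Y \<in> carrier_vec (Suc (Suc k))"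
    then obtain s x w t y z where X: "w \<in> carrier_vec k" "X = vCons s (vCons x w)"
      and Y: "z \<in> carrier_vec k" "Y = vCons t (vCons y z)"
      using split by metis
    let ?br = "semidirect_bracket (bordered_mat c v B)"
    have br: "?br (vCons s (vCons x w)) (vCons t (vCons y z)) =
        vCons 0 (vCons (c * (s * y - t * x)) ((s * y - t * x) \<cdot>\<^sub>v v + (s \<cdot>\<^sub>v (B *\<^sub>v z) - t \<cdot>\<^sub>v (B *\<^sub>v w))))"
      if "w \<in> carrier_vec k" "z \<in> carrier_vec k" for s x w t y z
    proof -
      have "?br (vCons s (vCons x w)) (vCons t (vCons y z)) =
        vCons 0 (vCons (s * (c * y) - t * (c * x)) (s \<cdot>\<^sub>v (y \<cdot>\<^sub>v v + B *\<^sub>v z) - t \<cdot>\<^sub>v (x \<cdot>\<^sub>v v + B *\<^sub>v w)))"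
        using v B that
        by (simp add: semidirect_bracket_vCons[of _ "Suc k"] bordered_mat_mult_vCons smult_vCons vCons_minus_vCons)
      moreover have "s \<cdot>\<^sub>v (y \<cdot>\<^sub>v v + B *\<^sub>v z) - t \<cdot>\<^sub>v (x \<cdot>\<^sub>v v + B *\<^sub>v w) =
         (s * y - t * x) \<cdot>\<^sub>v v + (s \<cdot>\<^sub>v (B *\<^sub>v z) - t \<cdot>\<^sub>v (B *\<^sub>v w))"
        using v B that by (intro eq_vecI) (auto simp: algebra_simps simp del: index_mult_mat_vec)
      ultimately show ?thesis by (simp add: algebra_simps)
    qed
    define p q p' q' where "p = B *\<^sub>v w" and "q = B *\<^sub>v z" and "p' = B *\<^sub>v (J *\<^sub>v w)" and "q' = B *\<^sub>v (J *\<^sub>v z)"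
    have carr: "p \<in> carrier_vec k" "q \<in> carrier_vec k" "p' \<in> carrier_vec k" "q' \<in> carrier_vec k"
      using X Y B J
      by (auto simp: p_def q_def p'_def q'_def intro!: mult_mat_vec_carrier[of _ k k])
    have J': "J *\<^sub>v p = p'" "J *\<^sub>v q = q'" "J *\<^sub>v p' = - p" "J *\<^sub>v q' = - q"
      using X Y J B by (simp_all add: p_def q_def p'_def q'_def JBv JJv mult_mat_uminus_vec[of _ k k]) 
    \<comment> \<open>The two mixed brackets carry opposite multiples of \<open>c\<close> and
      \<open>v\<close>, so their sum lies in the hyperplane and has no component along the first
      basis vector.\<close>
    define R where "R = (- x) \<cdot>\<^sub>v q + (- t) \<cdot>\<^sub>v p' + (s \<cdot>\<^sub>v q' + y \<cdot>\<^sub>v p)"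
    have "?br (j X) Y + ?br X (j Y) = vCons 0 (vCons 0 R)"
      using X Y J B v carr unfolding R_def
      by (auto simp: j br vCons_add_vCons algebra_simps
          p_def[symmetric] q_def[symmetric] p'_def[symmetric] q'_def[symmetric] intro!: eq_vecI
          simp del: index_mult_mat_vec)
    moreover have "J *\<^sub>v R = (- x) \<cdot>\<^sub>v q' + (- t) \<cdot>\<^sub>v (- p) + (s \<cdot>\<^sub>v (- q) + y \<cdot>\<^sub>v p')"
      using J carr by (simp add: R_def J' mult_add_distrib_mat_vec[of _ k k] mult_mat_vec[of _ k k])
    moreover have "R \<in> carrier_vec k" using carr by (simp add: R_def)
    ultimately have 1: "j (?br (j X) Y + ?br X (j Y)) =
        vCons 0 (vCons 0 ((- x) \<cdot>\<^sub>v q' + (- t) \<cdot>\<^sub>v (- p) + (s \<cdot>\<^sub>v (- q) + y \<cdot>\<^sub>v p')))"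
      by (simp add: j)
    have 2: "?br X Y = vCons 0 (vCons (c * (s * y - t * x)) ((s * y - t * x) \<cdot>\<^sub>v v + (s \<cdot>\<^sub>v q - t \<cdot>\<^sub>v p)))"
      using X Y by (simp add: br p_def q_def)
    have 3: "?br (j X) (j Y) = vCons 0 (vCons (c * (s * y - t * x))
        ((s * y - t * x) \<cdot>\<^sub>v v + ((- x) \<cdot>\<^sub>v q' - (- y) \<cdot>\<^sub>v p')))"
      using X Y J by (simp add: j br p'_def q'_def algebra_simps)
    show "?br X Y + j (?br (j X) Y + ?br X (j Y)) - ?br (j X) (j Y) = 0\<^sub>v (Suc (Suc k))"
      unfolding 1 2 3 using carr v
      by (auto simp: vCons_add_vCons vCons_minus_vCons zero_vec_Suc algebra_simps intro!: eq_vecI)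
  next
    fix X Y :: "real vec" assume "X \<in> carrier_vec (Suc (Suc k))" "Y \<in> carrier_vec (Suc (Suc k))"
    then obtain s x w t y z where X: "w \<in> carrier_vec k" "X = vCons s (vCons x w)"
      and Y: "z \<in> carrier_vec k" "Y = vCons t (vCons y z)"
      using split by metis
    with J show "j (X + Y) = j X + j Y"
      by (simp add: j vCons_add_vCons mult_add_distrib_mat_vec[of _ k k])
  qed (use J JJv in \<open>auto dest!: split simp: j smult_vCons uminus_vCons mult_mat_vec[of _ k k]\<close>)
  then show ?thesis unfolding admits_complex_structure_def by auto
qed

lemma admits_complex_structure_if_hyperplane_complexifiable:
  assumes "M \<in> carrier_mat (Suc k) (Suc k)" "hyperplane_complexifiable k M"
  shows "admits_complex_structure (Suc (Suc k)) (semidirect_bracket M)"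
  using assms admits_complex_structure_bordered_mat admits_complex_structure_similar
  unfolding hyperplane_complexifiable_def by blast

section \<open>From a complex structure to an invariant hyperplane\<close>

lemma index_mat_eq_mult_unit_vec:
  fixes A :: "'a :: semiring_1 mat"
  shows "A \<in> carrier_mat n m \<Longrightarrow> i < n \<Longrightarrow> j < m \<Longrightarrow> A $$ (i, j) = (A *\<^sub>v unit_vec m j) $ i"
  by simp

lemma linear_map_eq_mult_mat_vec:
  fixes f :: "'a :: field vec \<Rightarrow> 'a vec"
  assumes cl: "\<And>x. x \<in> carrier_vec n \<Longrightarrow> f x \<in> carrier_vec m"
    and add: "\<And>x y. x \<in> carrier_vec n \<Longrightarrow> y \<in> carrier_vec n \<Longrightarrow> f (x + y) = f x + f y"
    and smult: "\<And>c x. x \<in> carrier_vec n \<Longrightarrow> f (c \<cdot>\<^sub>v x) = c \<cdot>\<^sub>v f x"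
  shows "\<exists>A \<in> carrier_mat m n. \<forall>x \<in> carrier_vec n. f x = A *\<^sub>v x"
proof -
  define A where "A = mat m n (\<lambda>(i, j). f (unit_vec n j) $ i)"
  have A: "A \<in> carrier_mat m n" by (simp add: A_def)
  have unit: "f (unit_vec n j) = A *\<^sub>v unit_vec n j" if "j < n" for j
    using that cl[of "unit_vec n j"] by (intro eq_vecI) (auto simp: A_def)
  \<comment> \<open>Induction on a bound \<open>i\<close> for the support: each step splits off the
    last coordinate that may be nonzero.\<close>
  have "f x = A *\<^sub>v x" if "x \<in> carrier_vec n" "\<And>j. i \<le> j \<Longrightarrow> j < n \<Longrightarrow> x $ j = 0" for x i
    using that
  proof (induction i arbitrary: x)
    case 0
    then have "x = 0\<^sub>v n" by (intro eq_vecI) auto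
    moreover have "f (0\<^sub>v n) = 0\<^sub>v m"
      using smult[of "0\<^sub>v n" 0] cl[of "0\<^sub>v n"] by simp
    ultimately show ?case using A by simp
  next
    case (Suc i)
    show ?case
    proof (cases "i < n")
      case True
      define y where "y = vec n (\<lambda>j. if j = i then 0 else x $ j)"
      have y: "y \<in> carrier_vec n" by (simp add: y_def)
      have "x = y + x $ i \<cdot>\<^sub>v unit_vec n i"
        using Suc.prems(1) by (intro eq_vecI) (auto simp: y_def unit_vec_def)
      moreover have "f y = A *\<^sub>v y"
        using Suc.prems by (intro Suc.IH) (auto simp: y_def)
      ultimately show ?thesis
        using A y True Suc.prems(1) add smult unit
        by (metis mult_add_distrib_mat_vec mult_mat_vec smult_carrier_vec unit_vec_carrier)
    next
      case False
      with Suc show ?thesis by simp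
    qed
  qed
  from this[of _ n] A show ?thesis by (intro bexI[of _ A]) auto
qed

text \<open>This gives a basis in which the linear form \<open>r\<close> is the first coordinate, so
  that its kernel is spanned by the remaining basis vectors.\<close>

lemma extend_row_to_invertible_mat:
  fixes r :: "'a :: field vec"
  assumes r: "r \<in> carrier_vec (Suc k)" "r \<noteq> 0\<^sub>v (Suc k)"
  shows "\<exists>G \<in> carrier_mat (Suc k) (Suc k). \<exists>P \<in> carrier_mat (Suc k) (Suc k).
    row G 0 = r \<and> G * P = 1\<^sub>m (Suc k) \<and> P * G = 1\<^sub>m (Suc k)"
proof -
  from r obtain i where i: "i < Suc k" "r $ i \<noteq> 0"
    by (metis carrier_vecD eq_vecI index_zero_vec)
  \<comment> \<open>The form \<open>r\<close> is completed by all unit vectors except the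
    \<open>i\<close>-th, where \<open>r\<close> has a nonzero entry. Row 0 being taken by
    \<open>r\<close>, the unit vector of index 0 moves to row \<open>i\<close>.\<close>
  define G where "G = mat_of_rows (Suc k)
    (r # map (\<lambda>j. unit_vec (Suc k) (if j = i then 0 else j)) [1..<Suc k])"
  have row: "row G 0 = r" "j \<noteq> 0 \<Longrightarrow> j < Suc k \<Longrightarrow> row G j = unit_vec (Suc k) (if j = i then 0 else j)" for j
    using r unfolding G_def by (subst mat_of_rows_row; auto simp: nth_Cons' simp del: upt_Suc)+
  have G: "G \<in> carrier_mat (Suc k) (Suc k)" 
    unfolding G_def by (rule carrier_matI) (simp_all del: upt_Suc)
  have "v = 0\<^sub>v (Suc k)" if v: "v \<in> carrier_vec (Suc k)" "G *\<^sub>v v = 0\<^sub>v (Suc k)" for v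
  proof -
    have 0: "row G j \<bullet> v = 0" if "j < Suc k" for j
      using arg_cong[OF v(2), of "\<lambda>x. x $ j"] G that by simp
    have ne: "v $ j = 0" if "j < Suc k" "j \<noteq> i" for j
    proof (cases "j = 0")
      case True
      with 0[of i] row(2)[of i] that i v(1) show ?thesis by simp
    next
      case False
      with 0[of j] row(2)[of j] that v(1) show ?thesis by simp
    qed
    have "r \<bullet> v = (\<Sum>j\<in>{0..<Suc k}. if j = i then r $ i * v $ i else 0)"
      unfolding scalar_prod_def using v(1) ne by (intro sum.cong) auto
    also have "\<dots> = r $ i * v $ i" using i(1) by simp
    finally have "v $ i = 0" using 0[of 0] row(1) i(2) by simp
    then have "v $ j = 0" if "j < Suc k" for j using ne that by (cases "j = i") auto
    with v(1) show ?thesis by (intro eq_vecI) auto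
  qed
  then have "det G \<noteq> 0"
    using det_0_iff_vec_prod_zero_field[OF G] by auto
  from det_non_zero_imp_unit[OF G this, unfolded Units_def, of "()"]
  show ?thesis using G row(1) by (auto simp: ring_mat_def)
qed

text \<open>The linear form \<open>r\<close> is the e_0-coefficient of \<open>j\<close> on V, so j v
  lies in V exactly if r vanishes at v. Hence the kernel of \<open>r\<close> is V \<inter> j V, and
  there \<open>j\<close> is given by \<open>K\<close>, the V-part of \<open>j\<close>.\<close>

lemma hyperplane_complexifiable_if_admits_complex_structure:
  assumes M: "M \<in> carrier_mat (Suc k) (Suc k)"
    and "admits_complex_structure (Suc (Suc k)) (semidirect_bracket M)"
  shows "hyperplane_complexifiable k M"
proof -
  define d where "d = Suc k"
  note M = M[folded d_def]
  from assms(2) obtain j where "complex_structure (Suc d) (semidirect_bracket M) j"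
    unfolding admits_complex_structure_def d_def by auto
  then have j_cl: "x \<in> carrier_vec (Suc d) \<Longrightarrow> j x \<in> carrier_vec (Suc d)"
    and j_add: "x \<in> carrier_vec (Suc d) \<Longrightarrow> y \<in> carrier_vec (Suc d) \<Longrightarrow> j (x + y) = j x + j y"
    and j_smult: "x \<in> carrier_vec (Suc d) \<Longrightarrow> j (c \<cdot>\<^sub>v x) = c \<cdot>\<^sub>v j x"
    and j_square: "x \<in> carrier_vec (Suc d) \<Longrightarrow> j (j x) = - x"
    and j_integrable: "x \<in> carrier_vec (Suc d) \<Longrightarrow> y \<in> carrier_vec (Suc d) \<Longrightarrow>
      semidirect_bracket M x y + j (semidirect_bracket M (j x) y + semidirect_bracket M x (j y))
      - semidirect_bracket M (j x) (j y) = 0\<^sub>v (Suc d)" for x y c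
    unfolding complex_structure_def by (auto dest: bij_betwE)
  define q where "q x = vec_last x d" for x :: "real vec"
  have q: "q (vCons s v) = v" if "v \<in> carrier_vec d" for s v
    using that by (simp add: q_def vec_last_vCons)
  have j_split: "j x = vCons (j x $ 0) (q (j x))" "q (j x) \<in> carrier_vec d" if "x \<in> carrier_vec (Suc d)" for x
    using carrier_vec_SucE[OF j_cl[OF that]] q by (metis vec_index_vCons_0)+
  have j0_add: "j (vCons 0 (v + w)) = j (vCons 0 v) + j (vCons 0 w)"
    if "v \<in> carrier_vec d" "w \<in> carrier_vec d" for v w
    using j_add[of "vCons 0 v" "vCons 0 w"] that by (simp add: vCons_add_vCons)
  have j0_smult: "j (vCons 0 (c \<cdot>\<^sub>v v)) = c \<cdot>\<^sub>v j (vCons 0 v)" if "v \<in> carrier_vec d" for c v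
    using j_smult[of "vCons 0 v" c] that by (simp add: smult_vCons)
  have q_add: "q (x + y) = q x + q y" if "x \<in> carrier_vec (Suc d)" "y \<in> carrier_vec (Suc d)" for x y
    using that unfolding q_def vec_last_def by (intro eq_vecI) auto
  have q_smult: "q (c \<cdot>\<^sub>v x) = c \<cdot>\<^sub>v q x" if "x \<in> carrier_vec (Suc d)" for c x
    using that unfolding q_def vec_last_def by (intro eq_vecI) auto
  have "\<exists>K \<in> carrier_mat d d. \<forall>v \<in> carrier_vec d. q (j (vCons 0 v)) = K *\<^sub>v v"
    by (rule linear_map_eq_mult_mat_vec) (simp_all add: j_split(2) j0_add j0_smult q_add q_smult j_cl)
  then obtain K where K: "K \<in> carrier_mat d d" "\<And>v. v \<in> carrier_vec d \<Longrightarrow> q (j (vCons 0 v)) = K *\<^sub>v v"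
    by auto
  have "\<exists>F \<in> carrier_mat 1 d. \<forall>v \<in> carrier_vec d. vec 1 (\<lambda>_. j (vCons 0 v) $ 0) = F *\<^sub>v v"
    by (intro linear_map_eq_mult_mat_vec)
      (auto intro!: eq_vecI simp: j0_add j0_smult carrier_vecD[OF j_cl])
  then obtain F where F: "F \<in> carrier_mat 1 d"
    "\<And>v. v \<in> carrier_vec d \<Longrightarrow> vec 1 (\<lambda>_. j (vCons 0 v) $ 0) = F *\<^sub>v v"
    by auto
  define r where "r = row F 0"
  have r: "r \<in> carrier_vec d" using F by (auto simp: r_def)
  have "j (vCons 0 v) $ 0 = r \<bullet> v" if "v \<in> carrier_vec d" for v
    using arg_cong[OF F(2)[OF that], of "\<lambda>x. x $ 0"] F(1) by (simp add: r_def)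
  with j_split K have j0: "j (vCons 0 v) = vCons (r \<bullet> v) (K *\<^sub>v v)" if "v \<in> carrier_vec d" for v
    using that by (metis vCons_carrier_vec)
  have e0: "vCons 1 (0\<^sub>v d) \<in> carrier_vec (Suc d)" by simp
  obtain s u where u: "u \<in> carrier_vec d" "j (vCons 1 (0\<^sub>v d)) = vCons s u"
    using carrier_vec_SucE[OF j_cl[OF e0]] by metis
  have dim_u: "dim_vec u = d" using u by simp
  have j: "j (vCons t v) = vCons (t * s + r \<bullet> v) (t \<cdot>\<^sub>v u + K *\<^sub>v v)" if "v \<in> carrier_vec d" for t v
  proof -
    have "vCons t v = t \<cdot>\<^sub>v vCons 1 (0\<^sub>v d) + vCons 0 v"
      using that by (auto intro!: eq_vecI simp: smult_vCons vCons_add_vCons vec_index_vCons)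
    then have "j (vCons t v) = t \<cdot>\<^sub>v vCons s u + vCons (r \<bullet> v) (K *\<^sub>v v)"
      using that by (simp add: j_add j_smult e0 u(2) j0)
    with u K that show ?thesis by (simp add: smult_vCons vCons_add_vCons)
  qed
  have Kc: "K *\<^sub>v v \<in> carrier_vec d" and Mc: "M *\<^sub>v v \<in> carrier_vec d" if "v \<in> carrier_vec d" for v
    using K M that by (auto intro: mult_mat_vec_carrier)
  \<comment> \<open>This is the e_0-component of j (j e_0) = - e_0. Since s is real,
    \<open>r\<close> cannot be zero, so its kernel is a proper hyperplane.\<close>
  have "s * s + r \<bullet> u = - 1"
    using j_square[OF e0] u Kc by (simp add: j uminus_vCons)
  moreover have "s * s \<ge> 0" by simp
  ultimately have "r \<bullet> u \<noteq> 0" by linarith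
  with u have "r \<noteq> 0\<^sub>v d" by auto
  with extend_row_to_invertible_mat r obtain G P where
    G: "G \<in> carrier_mat d d" and P: "P \<in> carrier_mat d d" and row_G: "row G 0 = r"
    and GP: "G * P = 1\<^sub>m d" and PG: "P * G = 1\<^sub>m d"
    unfolding d_def by metis
  have hyp: "r \<bullet> (K *\<^sub>v w) = 0" "K *\<^sub>v (K *\<^sub>v w) = - w" if "w \<in> carrier_vec d" "r \<bullet> w = 0" for w
    using j_square[of "vCons 0 w"] that by (simp_all add: j Kc uminus_vCons dim_u)
  \<comment> \<open>These are the e_0-component and the V-component of the integrability identity at
    e_0 and \<open>w\<close>.\<close>
  have integrable: "s * (r \<bullet> (M *\<^sub>v w)) + r \<bullet> (M *\<^sub>v (K *\<^sub>v w)) = 0"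
    "M *\<^sub>v w + (s \<cdot>\<^sub>v (K *\<^sub>v (M *\<^sub>v w)) + K *\<^sub>v (M *\<^sub>v (K *\<^sub>v w))) - s \<cdot>\<^sub>v (M *\<^sub>v (K *\<^sub>v w)) = 0\<^sub>v d"
    if w: "w \<in> carrier_vec d" "r \<bullet> w = 0" for w
  proof -
    have zM: "M *\<^sub>v 0\<^sub>v d = 0\<^sub>v d" using M by (intro eq_vecI) auto
    note [simp] = semidirect_bracket_vCons[OF M] Kc Mc u zM carrier_matD[OF M] carrier_matD[OF K(1)]
    have minus_zero: "x - 0\<^sub>v d = x" if "x \<in> carrier_vec d" for x :: "real vec"
      using that by (intro eq_vecI) auto
    note [simp] = minus_zero
    have 1: "semidirect_bracket M (vCons 1 (0\<^sub>v d)) (vCons 0 w) = vCons 0 (M *\<^sub>v w)"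
      using w by simp
    have 2: "semidirect_bracket M (vCons s u) (vCons 0 w) + semidirect_bracket M (vCons 1 (0\<^sub>v d)) (vCons 0 (K *\<^sub>v w))
        = vCons 0 (s \<cdot>\<^sub>v (M *\<^sub>v w) + M *\<^sub>v (K *\<^sub>v w))"
      using w by (simp add: vCons_add_vCons)
    have 3: "semidirect_bracket M (vCons s u) (vCons 0 (K *\<^sub>v w)) = vCons 0 (s \<cdot>\<^sub>v (M *\<^sub>v (K *\<^sub>v w)))"
      using w by simp
    have jw: "j (vCons 0 w) = vCons 0 (K *\<^sub>v w)"
      using j0 w by simp
    have 4: "j (vCons 0 (s \<cdot>\<^sub>v (M *\<^sub>v w) + M *\<^sub>v (K *\<^sub>v w))) =
        vCons (s * (r \<bullet> (M *\<^sub>v w)) + r \<bullet> (M *\<^sub>v (K *\<^sub>v w))) (s \<cdot>\<^sub>v (K *\<^sub>v (M *\<^sub>v w)) + K *\<^sub>v (M *\<^sub>v (K *\<^sub>v w)))"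
      using w r K by (simp add: j0 scalar_prod_add_distrib[of _ d] mult_add_distrib_mat_vec[of _ d d]
          mult_mat_vec[of _ d d])
    have "vCons 0 (M *\<^sub>v w) + vCons (s * (r \<bullet> (M *\<^sub>v w)) + r \<bullet> (M *\<^sub>v (K *\<^sub>v w)))
         (s \<cdot>\<^sub>v (K *\<^sub>v (M *\<^sub>v w)) + K *\<^sub>v (M *\<^sub>v (K *\<^sub>v w))) - vCons 0 (s \<cdot>\<^sub>v (M *\<^sub>v (K *\<^sub>v w))) = vCons 0 (0\<^sub>v d)"
      using j_integrable[of "vCons 1 (0\<^sub>v d)" "vCons 0 w"] w
      unfolding u(2) jw 1 2 3 4 by (simp add: zero_vec_Suc)
    moreover have "dim_vec (M *\<^sub>v w) = d" "dim_vec (K *\<^sub>v (M *\<^sub>v (K *\<^sub>v w))) = d" "dim_vec (M *\<^sub>v (K *\<^sub>v w)) = d"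
      using M K by auto
    ultimately show "s * (r \<bullet> (M *\<^sub>v w)) + r \<bullet> (M *\<^sub>v (K *\<^sub>v w)) = 0"
      "M *\<^sub>v w + (s \<cdot>\<^sub>v (K *\<^sub>v (M *\<^sub>v w)) + K *\<^sub>v (M *\<^sub>v (K *\<^sub>v w))) - s \<cdot>\<^sub>v (M *\<^sub>v (K *\<^sub>v w)) = 0\<^sub>v d"
      by (simp_all add: vCons_add_vCons vCons_minus_vCons)
  qed
  \<comment> \<open>The first relation, taken at \<open>w\<close> and at
    \<open>K *\<^sub>v w\<close>, is a linear system for the values of \<open>r\<close> at M w and M
    K w, with determinant s^2 + 1.\<close>
  have inv: "r \<bullet> (M *\<^sub>v w) = 0" if w: "w \<in> carrier_vec d" "r \<bullet> w = 0" for w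
  proof -
    have "M *\<^sub>v (- w) = - (M *\<^sub>v w)" using M w by (simp add: mult_mat_uminus_vec)
    moreover have "r \<bullet> - (M *\<^sub>v w) = - (r \<bullet> (M *\<^sub>v w))"
      using r M by (subst scalar_prod_uminus_right) simp_all
    ultimately have "s * (r \<bullet> (M *\<^sub>v (K *\<^sub>v w))) - r \<bullet> (M *\<^sub>v w) = 0"
      using integrable(1)[of "K *\<^sub>v w"] w Kc by (simp add: hyp)
    moreover have "r \<bullet> (M *\<^sub>v (K *\<^sub>v w)) = - (s * (r \<bullet> (M *\<^sub>v w)))"
      using integrable(1)[OF w] by linarith
    ultimately have "(s * s + 1) * (r \<bullet> (M *\<^sub>v w)) = 0"
      by (simp add: algebra_simps)
    moreover have "s * s + 1 \<noteq> 0"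
      using zero_le_square[of s] by linarith
    ultimately show ?thesis by simp
  qed
  have comm: "K *\<^sub>v (M *\<^sub>v w) = M *\<^sub>v (K *\<^sub>v w)" if w: "w \<in> carrier_vec d" "r \<bullet> w = 0" for w
  proof -
    \<comment> \<open>The second relation says that the commutator value \<open>D\<close> satisfies
      K D = s D. As K^2 = -1 on the hyperplane and s is real, \<open>D\<close> vanishes.\<close>
    define D where "D = K *\<^sub>v (M *\<^sub>v w) - M *\<^sub>v (K *\<^sub>v w)"
    have D: "D \<in> carrier_vec d" using w Mc Kc by (simp add: D_def)
    have rMw: "r \<bullet> (M *\<^sub>v w) = 0" "r \<bullet> (M *\<^sub>v (K *\<^sub>v w)) = 0"
      using w by (auto intro!: inv hyp simp: Kc)
    have rD: "r \<bullet> D = 0"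
      unfolding D_def using w r Mc Kc rMw hyp(1)[of "M *\<^sub>v w"] by (simp add: scalar_prod_minus_distrib[of _ d])
    have "K *\<^sub>v D = - (M *\<^sub>v w) - K *\<^sub>v (M *\<^sub>v (K *\<^sub>v w))"
      unfolding D_def using w K Mc Kc rMw hyp(2)[of "M *\<^sub>v w"] by (simp add: mult_minus_distrib_mat_vec[of _ d d])
    moreover have "- (M *\<^sub>v w) - K *\<^sub>v (M *\<^sub>v (K *\<^sub>v w)) = s \<cdot>\<^sub>v D"
    proof (rule eq_vecI)
      fix i assume "i < dim_vec (s \<cdot>\<^sub>v D)"
      with D have "i < d" by simp
      with arg_cong[OF integrable(2)[OF w], of "\<lambda>x. x $ i"] K M
      show "(- (M *\<^sub>v w) - K *\<^sub>v (M *\<^sub>v (K *\<^sub>v w))) $ i = (s \<cdot>\<^sub>v D) $ i"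
        by (simp add: D_def algebra_simps del: index_mult_mat_vec)
    qed (use D K in simp)
    ultimately have KD: "K *\<^sub>v D = s \<cdot>\<^sub>v D" by simp
    then have "- D = (s * s) \<cdot>\<^sub>v D"
      using hyp(2)[OF D rD] K D by (simp add: mult_mat_vec[of _ d d] smult_smult_assoc)
    have "D $ i = 0" if "i < d" for i
    proof -
      have "- (D $ i) = s * s * D $ i"
        using arg_cong[OF \<open>- D = (s * s) \<cdot>\<^sub>v D\<close>, of "\<lambda>x. x $ i"] that D by simp
      then have "(s * s + 1) * D $ i = 0" by (simp add: algebra_simps)
      moreover have "s * s + 1 \<noteq> 0"
        using zero_le_square[of s] by linarith
      ultimately show ?thesis by simp
    qed
    with K M show ?thesis
      unfolding D_def by (intro eq_vecI) (simp_all del: index_mult_mat_vec)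
  qed
  let ?conj = "\<lambda>Z. G * Z * P"
  have conj: "?conj Z *\<^sub>v x = G *\<^sub>v (Z *\<^sub>v (P *\<^sub>v x))" if "Z \<in> carrier_mat d d" "x \<in> carrier_vec d" for Z x
    using G P that by (simp add: assoc_mult_mat_vec[of _ d d _ d])
  have W: "r \<bullet> (P *\<^sub>v vCons 0 y) = 0" "P *\<^sub>v vCons 0 y \<in> carrier_vec d" if "y \<in> carrier_vec k" for y
  proof -
    have "G *\<^sub>v (P *\<^sub>v vCons 0 y) = vCons 0 y"
      using that G P GP assoc_mult_mat_vec[of G d d P d "vCons 0 y"] by (simp add: d_def)
    then show "r \<bullet> (P *\<^sub>v vCons 0 y) = 0"
      using row_G G d_def by (metis carrier_matD(1) index_mult_mat_vec vec_index_vCons_0 zero_less_Suc)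
    show "P *\<^sub>v vCons 0 y \<in> carrier_vec d" using P that by (simp add: d_def mult_mat_vec_carrier)
  qed
  \<comment> \<open>In the new basis, preserving the kernel of \<open>r\<close> means a first row
    that vanishes off the diagonal. This is applied to \<open>M\<close> and to
    \<open>K\<close>.\<close>
  have first_row: "\<exists>c. \<exists>v \<in> carrier_vec k. \<exists>B \<in> carrier_mat k k. ?conj Z = bordered_mat c v B"
    if Z: "Z \<in> carrier_mat d d" and inv: "\<And>w. w \<in> carrier_vec d \<Longrightarrow> r \<bullet> w = 0 \<Longrightarrow> r \<bullet> (Z *\<^sub>v w) = 0" for Z
  proof -
    have ZP: "?conj Z \<in> carrier_mat (Suc k) (Suc k)"
      using Z G P by (simp add: d_def)
    have "?conj Z $$ (0, Suc i) = 0" if "i < k" for i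
    proof -
      have "unit_vec (Suc k) (Suc i) = (vCons 0 (unit_vec k i) :: real vec)"
        using that by (intro eq_vecI) (auto simp: vec_index_vCons)
      then have "?conj Z $$ (0, Suc i) = (?conj Z *\<^sub>v vCons 0 (unit_vec k i)) $ 0"
        using index_mat_eq_mult_unit_vec[OF ZP, of 0 "Suc i"] that by simp
      also have "\<dots> = (G *\<^sub>v (Z *\<^sub>v (P *\<^sub>v vCons 0 (unit_vec k i)))) $ 0"
        by (subst conj[OF Z]) (simp_all add: d_def)
      also have "\<dots> = r \<bullet> (Z *\<^sub>v (P *\<^sub>v vCons 0 (unit_vec k i)))"
        using G row_G by (simp add: d_def)
      also have "\<dots> = 0" by (intro inv W) simp_all
      finally show ?thesis .
    qed
    from bordered_mat_if_first_row[OF ZP this] show ?thesis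
      by (intro exI bexI) auto
  qed
  obtain c v B where B: "v \<in> carrier_vec k" "B \<in> carrier_mat k k" "?conj M = bordered_mat c v B"
    using first_row[OF M inv] by blast
  obtain c' v' J where J: "v' \<in> carrier_vec k" "J \<in> carrier_mat k k" "?conj K = bordered_mat c' v' J"
    using first_row[OF K(1) hyp(1)] by blast
  have actB: "G *\<^sub>v (M *\<^sub>v (P *\<^sub>v vCons 0 y)) = vCons 0 (B *\<^sub>v y)"
    and actJ: "G *\<^sub>v (K *\<^sub>v (P *\<^sub>v vCons 0 y)) = vCons 0 (J *\<^sub>v y)" if "y \<in> carrier_vec k" for y
    using conj[OF M, of "vCons 0 y"] conj[OF K(1), of "vCons 0 y"] that B J
      mult_mat_vec_carrier[OF B(2) that] mult_mat_vec_carrier[OF J(2) that]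
    by (simp_all add: d_def bordered_mat_mult_vCons)
  have PGv: "P *\<^sub>v (G *\<^sub>v x) = x" if "x \<in> carrier_vec d" for x
    using that G P PG assoc_mult_mat_vec[of P d d G d x] by simp
  have PB: "P *\<^sub>v vCons 0 (B *\<^sub>v y) = M *\<^sub>v (P *\<^sub>v vCons 0 y)"
    and PJ: "P *\<^sub>v vCons 0 (J *\<^sub>v y) = K *\<^sub>v (P *\<^sub>v vCons 0 y)" if "y \<in> carrier_vec k" for y
    using PGv[OF Mc[OF W(2)[OF that]]] PGv[OF Kc[OF W(2)[OF that]]] unfolding actB[OF that] actJ[OF that]
    by auto
  have By: "B *\<^sub>v y \<in> carrier_vec k" and Jy: "J *\<^sub>v y \<in> carrier_vec k" if "y \<in> carrier_vec k" for y
    using that B J by (auto intro: mult_mat_vec_carrier)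
  have inj: "x = y" if "P *\<^sub>v vCons 0 x = P *\<^sub>v vCons 0 y" "x \<in> carrier_vec k" "y \<in> carrier_vec k" for x y
  proof -
    have "G * P *\<^sub>v vCons 0 x = G * P *\<^sub>v vCons 0 y"
      using that G P by (simp add: assoc_mult_mat_vec[of G d d P d] d_def)
    with that show ?thesis by (simp add: GP d_def)
  qed
  have "J * B = B * J"
  proof (rule mat_eq_by_mult_vec)
    fix y :: "real vec" assume y: "y \<in> carrier_vec k"
    have "J *\<^sub>v (B *\<^sub>v y) = B *\<^sub>v (J *\<^sub>v y)"
      by (rule inj) (simp_all only: PB[OF y] PJ[OF y] PB[OF Jy[OF y]] PJ[OF By[OF y]] comm[OF W(2,1)[OF y]] By Jy y)
    with y B J show "J * B *\<^sub>v y = B * J *\<^sub>v y" by simp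
  qed (use B J in auto)
  moreover have "J * J = - 1\<^sub>m k"
  proof (rule mat_eq_by_mult_vec)
    fix y :: "real vec" assume y: "y \<in> carrier_vec k"
    have neg: "- (P *\<^sub>v vCons 0 y) = P *\<^sub>v vCons 0 (- y)"
      using y mult_mat_uminus_vec[of P d d "vCons 0 y"] P by (simp add: d_def uminus_vCons)
    have "J *\<^sub>v (J *\<^sub>v y) = - y"
      by (rule inj) (simp_all add: neg PJ[OF Jy[OF y]] PJ[OF y] hyp(2)[OF W(2,1)[OF y]] Jy y)
    with y J show "J * J *\<^sub>v y = - 1\<^sub>m k *\<^sub>v y" by (simp add: uminus_mult_one_mat_vec)
  qed (use J in auto)
  ultimately have "complexifiable k B"
    using B J unfolding complexifiable_def by (intro conjI bexI[of _ J]) simp_all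
  moreover have "similar_mat M (bordered_mat c v B)"
  proof (rule similar_matI[of _ _ P G d])
    have "P * (G * M * P) * G = (P * G) * M * (P * G)"
      using P G M by (simp add: assoc_mult_mat[of _ d d _ d _ d])
    also have "\<dots> = M"
      using M by (simp add: PG)
    finally show "M = P * bordered_mat c v B * G"
      unfolding B(3) by (rule sym)
    show "{M, bordered_mat c v B, P, G} \<subseteq> carrier_mat d d"
      using M P G bordered_mat_carrier[OF B(2)] by (simp add: d_def)
  qed (rule PG GP)+
  ultimately show ?thesis
    using B(1) unfolding hyperplane_complexifiable_def by blast
qed

section \<open>Parity of generalized eigenspaces\<close>

lemma kernel_dim_eq_if_mat_kernel_eq:
  assumes "A \<in> carrier_mat nr n" "B \<in> carrier_mat nr' n" "mat_kernel A = mat_kernel B"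
  shows "kernel_dim A = kernel_dim B"
  using assms unfolding kernel_dim_def by (simp add: carrier_matD)

lemma kernel_dim_one_mat [simp]: "kernel_dim (1\<^sub>m n :: 'a :: field mat) = 0"
  using kernel_one_mat(1)[where 'a = 'a] by (simp add: kernel_dim_def)

lemma kernel_dim_four_block:
  assumes "A \<in> carrier_mat n n" "B \<in> carrier_mat m m"
  shows "kernel_dim (four_block_mat A (0\<^sub>m n m) (0\<^sub>m m n) B) = kernel_dim A + kernel_dim B"
  using kernel_four_block_0_mat[OF refl assms] assms by (simp add: kernel_dim_def)

lemma kernel_dim_zero_if_inverse:
  assumes "A \<in> carrier_mat n n" "C \<in> carrier_mat n n" "C * A = (1\<^sub>m n :: 'a :: field mat)"
  shows "kernel_dim A = 0"
proof -
  have "mat_kernel A = mat_kernel (1\<^sub>m n)"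
    using mat_kernel_mult_eq[OF assms(1,2,1)] assms mat_mult_left_right_inverse[OF assms(2,1,3)] by simp
  from kernel_dim_eq_if_mat_kernel_eq[OF assms(1) one_carrier_mat this] show ?thesis by simp
qed

lemma kernel_dim_zero_mat [simp]: "kernel_dim (0\<^sub>m n n :: 'a :: field mat) = n"
proof -
  have ref: "row_echelon_form (0\<^sub>m n n :: 'a mat)"
    unfolding row_echelon_form_def by (intro exI[of _ "\<lambda>_. n"] pivot_funI) auto
  have rows: "{i. i < n \<and> row (0\<^sub>m n n :: 'a mat) i \<noteq> 0\<^sub>v n} = {}"
    by (auto intro!: eq_vecI)
  show ?thesis
    using find_base_vectors(6)[OF ref zero_carrier_mat, unfolded rows] by (simp add: kernel_dim_def)
qed

text \<open>The columns of \<open>S\<close> are a basis of the kernel, so \<open>S\<close> turns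
  coordinate vectors into kernel vectors bijectively. This lets maps on the kernel be written as
  matrices of size \<open>kernel_dim X\<close>.\<close>

lemma kernel_frame_exists:
  fixes X :: "'a :: field mat"
  assumes X: "X \<in> carrier_mat nr n"
  shows "\<exists>S \<in> carrier_mat n (kernel_dim X). X * S = 0\<^sub>m nr (kernel_dim X) \<and>
    (\<forall>x \<in> mat_kernel X. \<exists>c \<in> carrier_vec (kernel_dim X). x = S *\<^sub>v c) \<and>
    (\<forall>c \<in> carrier_vec (kernel_dim X). S *\<^sub>v c = 0\<^sub>v n \<longrightarrow> c = 0\<^sub>v (kernel_dim X))"
proof -
  interpret K: kernel nr n X by (unfold_locales, rule X)
  from kernel_basis_exists[OF X] obtain B where B: "finite B" "K.basis B" by auto
  then have gen: "K.span B = mat_kernel X" and sub: "B \<subseteq> mat_kernel X" and indep: "\<not> K.lin_dep B"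
    unfolding K.Ker.basis_def by auto
  have card: "kernel_dim X = card B"
    using K.Ker.dim_basis[OF B] by simp
  have subc: "B \<subseteq> carrier_vec n" using sub mat_kernel_carrier[OF X] by auto
  obtain bs where bs: "set bs = B" "distinct bs"
    using finite_distinct_list[OF B(1)] by auto
  have len: "length bs = kernel_dim X" using bs card distinct_card[of bs] by simp
  define S where "S = mat_of_cols n bs"
  have S: "S \<in> carrier_mat n (kernel_dim X)" using len by (auto simp: S_def)
  have lc: "K.NC.lincomb_list f bs = S *\<^sub>v vec (kernel_dim X) f" for f
    unfolding S_def len[symmetric] using bs subc by (intro K.NC.lincomb_list_as_mat_mult) auto
  have "X * S = 0\<^sub>m nr (kernel_dim X)"
  proof (rule eq_matI)
    fix i j assume "i < dim_row (0\<^sub>m nr (kernel_dim X) :: 'a mat)" "j < dim_col (0\<^sub>m nr (kernel_dim X) :: 'a mat)"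
    then have ij: "i < nr" "j < kernel_dim X" by auto
    then have b: "bs ! j \<in> B" using len bs by auto
    then have "X *\<^sub>v (bs ! j) = 0\<^sub>v nr" using sub mat_kernelD[OF X] by auto
    moreover have "col S j = bs ! j" using b subc ij len by (auto simp: S_def)
    ultimately show "(X * S) $$ (i, j) = 0\<^sub>m nr (kernel_dim X) $$ (i, j)"
      using ij X S by (metis carrier_matD index_mult_mat(1) index_mult_mat_vec index_zero_mat(1) index_zero_vec(1))
  qed (use X S in auto)
  moreover have "\<exists>c \<in> carrier_vec (kernel_dim X). x = S *\<^sub>v c" if "x \<in> mat_kernel X" for x
  proof -
    from that gen K.span_same[OF sub] have "x \<in> K.NC.span B" by simp
    then obtain a where "x = K.NC.lincomb a B"
      using K.NC.finite_in_span[OF B(1) subc] by auto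
    also have "\<dots> = K.NC.lincomb_list (\<lambda>i. a (bs ! i)) bs"
      using K.NC.lincomb_as_lincomb_list_distinct[of bs a] bs subc by simp
    also have "\<dots> = S *\<^sub>v vec (kernel_dim X) (\<lambda>i. a (bs ! i))" by (rule lc)
    finally show ?thesis by (intro bexI[of _ "vec (kernel_dim X) (\<lambda>i. a (bs ! i))"]) auto
  qed
  moreover have "c = 0\<^sub>v (kernel_dim X)" if c: "c \<in> carrier_vec (kernel_dim X)" "S *\<^sub>v c = 0\<^sub>v n" for c
  proof -
    \<comment> \<open>Linear dependence speaks of coefficient functions on the set \<open>B\<close>;
      a coordinate vector becomes one by looking up the position of a vector in the distinct
      list.\<close>
    define a where "a b = c $ (THE i. i < length bs \<and> bs ! i = b)" for b
    have a: "a (bs ! i) = c $ i" if "i < length bs" for i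
      unfolding a_def using that bs(2) by (intro arg_cong[of _ _ "($) c"] the_equality) (auto simp: nth_eq_iff_index_eq)
    have "vec (kernel_dim X) (\<lambda>i. a (bs ! i)) = c"
      using a c len by (intro eq_vecI) auto
    then have "K.NC.lincomb a B = 0\<^sub>v n"
      using K.NC.lincomb_as_lincomb_list_distinct[of bs a] bs subc lc[of "\<lambda>i. a (bs ! i)"] c by simp
    then have "\<forall>b \<in> B. a b = 0"
      using indep B(1) sub K.lindep_same[OF sub] K.NC.lin_dep_def[of B]
      by (auto simp: module_vec_simps class_ring_simps)
    then show ?thesis
      using a bs len c by (intro eq_vecI) auto
  qed
  ultimately show ?thesis using S by blast
qed

text \<open>The matrix \<open>S\<close> includes a subspace invariant under \<open>J\<close>, and
  \<open>Q\<close> is \<open>B\<close> restricted to it. Injectivity makes the coordinates of J S c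
  unique, hence linear in c, and the relations for \<open>J\<close> pass to them. The subspace will
  be a kernel or the complementary summand.\<close>

lemma complexifiable_restrict:
  assumes B: "B \<in> carrier_mat n n" and J: "J \<in> carrier_mat n n" "J * J = - 1\<^sub>m n" "B * J = J * B"
    and S: "S \<in> carrier_mat n d" and Q: "Q \<in> carrier_mat d d" "B * S = S * Q"
    and inj: "\<And>c. c \<in> carrier_vec d \<Longrightarrow> S *\<^sub>v c = 0\<^sub>v n \<Longrightarrow> c = 0\<^sub>v d"
    and invariant: "\<And>c. c \<in> carrier_vec d \<Longrightarrow> \<exists>c' \<in> carrier_vec d. J *\<^sub>v (S *\<^sub>v c) = S *\<^sub>v c'"
  shows "complexifiable d Q"
proof -
  define f where "f c = (SOME c'. c' \<in> carrier_vec d \<and> J *\<^sub>v (S *\<^sub>v c) = S *\<^sub>v c')" for c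
  have f: "f c \<in> carrier_vec d" "J *\<^sub>v (S *\<^sub>v c) = S *\<^sub>v f c" if "c \<in> carrier_vec d" for c
    using someI_ex[of "\<lambda>c'. c' \<in> carrier_vec d \<and> J *\<^sub>v (S *\<^sub>v c) = S *\<^sub>v c'"] invariant[OF that]
    unfolding f_def by blast+
  have S_inj: "c = c'" if "S *\<^sub>v c = S *\<^sub>v c'" "c \<in> carrier_vec d" "c' \<in> carrier_vec d" for c c'
  proof -
    have "S *\<^sub>v (c - c') = 0\<^sub>v n"
      using that S by (simp add: mult_minus_distrib_mat_vec)
    with inj[of "c - c'"] that have 0: "c - c' = 0\<^sub>v d" by simp
    have "c $ i = c' $ i" if "i < d" for i
      using arg_cong[OF 0, of "\<lambda>x. x $ i"] that \<open>c' \<in> carrier_vec d\<close> by simp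
    with that show ?thesis by (intro eq_vecI) auto
  qed
  have Sc: "S *\<^sub>v c \<in> carrier_vec n" if "c \<in> carrier_vec d" for c
    using S that by (auto intro: mult_mat_vec_carrier)
  have "\<exists>K \<in> carrier_mat d d. \<forall>c \<in> carrier_vec d. f c = K *\<^sub>v c"
  proof (rule linear_map_eq_mult_mat_vec)
    fix x y :: "real vec" assume xy: "x \<in> carrier_vec d" "y \<in> carrier_vec d"
    have "S *\<^sub>v f (x + y) = J *\<^sub>v (S *\<^sub>v (x + y))"
      using xy f(2)[of "x + y"] by simp
    also have "\<dots> = J *\<^sub>v (S *\<^sub>v x) + J *\<^sub>v (S *\<^sub>v y)"
      using xy S J Sc by (simp add: mult_add_distrib_mat_vec[of _ n])
    also have "\<dots> = S *\<^sub>v (f x + f y)"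
      using xy S f(1) by (simp add: f(2) mult_add_distrib_mat_vec[of _ n d])
    finally show "f (x + y) = f x + f y"
      using xy f(1) by (intro S_inj[of "f (x + y)"]) simp_all
  next
    fix c and x :: "real vec" assume x: "x \<in> carrier_vec d"
    have "S *\<^sub>v f (c \<cdot>\<^sub>v x) = J *\<^sub>v (S *\<^sub>v (c \<cdot>\<^sub>v x))"
      using x f(2)[of "c \<cdot>\<^sub>v x"] by simp
    also have "\<dots> = c \<cdot>\<^sub>v (J *\<^sub>v (S *\<^sub>v x))"
      using x S J Sc by (simp add: mult_mat_vec[of _ n])
    also have "\<dots> = S *\<^sub>v (c \<cdot>\<^sub>v f x)"
      using x S f(1) by (simp add: f(2) mult_mat_vec[of _ n d])
    finally show "f (c \<cdot>\<^sub>v x) = c \<cdot>\<^sub>v f x"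
      using x f(1) by (intro S_inj[of "f (c \<cdot>\<^sub>v x)"]) simp_all
  qed (rule f)
  then obtain K where K: "K \<in> carrier_mat d d" "\<And>c. c \<in> carrier_vec d \<Longrightarrow> f c = K *\<^sub>v c" by auto
  have "K * K = - 1\<^sub>m d"
  proof (rule mat_eq_by_mult_vec)
    fix c :: "real vec" assume c: "c \<in> carrier_vec d"
    have "S *\<^sub>v f (f c) = J *\<^sub>v (J *\<^sub>v (S *\<^sub>v c))"
      using c f(1) by (simp add: f(2))
    also have "\<dots> = - (S *\<^sub>v c)"
      using assoc_mult_mat_vec[OF J(1,1) Sc[OF c]] Sc[OF c] by (simp add: J(2) uminus_mult_one_mat_vec)
    also have "\<dots> = S *\<^sub>v (- c)"
      using S c by (simp add: mult_mat_uminus_vec)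
    finally have "f (f c) = - c"
      using c f(1) by (intro S_inj[of "f (f c)"]) simp_all
    with c K f show "K * K *\<^sub>v c = - 1\<^sub>m d *\<^sub>v c"
      by (simp add: uminus_mult_one_mat_vec)
  qed (use K in auto)
  moreover have "Q * K = K * Q"
  proof (rule mat_eq_by_mult_vec)
    fix c :: "real vec" assume c: "c \<in> carrier_vec d"
    have BS: "B *\<^sub>v (S *\<^sub>v x) = S *\<^sub>v (Q *\<^sub>v x)" if "x \<in> carrier_vec d" for x
      using assoc_mult_mat_vec[OF B S that] assoc_mult_mat_vec[OF S Q(1) that] by (simp add: Q(2))
    have Qc: "Q *\<^sub>v c \<in> carrier_vec d"
      using Q(1) c by (rule mult_mat_vec_carrier)
    have "S *\<^sub>v (Q *\<^sub>v f c) = B *\<^sub>v (J *\<^sub>v (S *\<^sub>v c))"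
      using BS[OF f(1)[OF c]] f(2)[OF c] by simp
    also have "\<dots> = J *\<^sub>v (B *\<^sub>v (S *\<^sub>v c))"
      using assoc_mult_mat_vec[OF B J(1) Sc[OF c]] assoc_mult_mat_vec[OF J(1) B Sc[OF c]] by (simp add: J(3))
    also have "\<dots> = S *\<^sub>v f (Q *\<^sub>v c)"
      using BS[OF c] f(2)[OF Qc] by simp
    finally have "Q *\<^sub>v f c = f (Q *\<^sub>v c)"
      using f(1)[OF c] f(1)[OF Qc] Q(1) by (intro S_inj[of "Q *\<^sub>v f c"]) (auto intro: mult_mat_vec_carrier)
    with c K Q(1) Qc show "Q * K *\<^sub>v c = K * Q *\<^sub>v c" by simp
  qed (use K Q in auto)
  ultimately show ?thesis
    unfolding complexifiable_def using K Q by blast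
qed

section \<open>Even kernels, and the effect of bordering on them\<close>

lemma even_if_complexifiable:
  "complexifiable k B \<Longrightarrow> even k"
  unfolding complexifiable_def using even_if_complex_structure_mat by blast

lemma even_kernel_dim_if_complexifiable:
  assumes "complexifiable n X"
  shows "even (kernel_dim X)"
proof -
  from assms obtain J where X: "X \<in> carrier_mat n n" and J: "J \<in> carrier_mat n n" "J * J = - 1\<^sub>m n"
    and comm: "X * J = J * X"
    unfolding complexifiable_def by auto
  define d where "d = kernel_dim X"
  from kernel_frame_exists[OF X] obtain S where S: "S \<in> carrier_mat n d" "X * S = 0\<^sub>m n d"
    and span: "\<And>x. x \<in> mat_kernel X \<Longrightarrow> \<exists>c \<in> carrier_vec d. x = S *\<^sub>v c"
    and inj: "\<And>c. c \<in> carrier_vec d \<Longrightarrow> S *\<^sub>v c = 0\<^sub>v n \<Longrightarrow> c = 0\<^sub>v d"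
    unfolding d_def by blast
  have ker: "J *\<^sub>v (S *\<^sub>v c) \<in> mat_kernel X" if c: "c \<in> carrier_vec d" for c
  proof (rule mat_kernelI[OF X])
    have "X *\<^sub>v (J *\<^sub>v (S *\<^sub>v c)) = (J * X) *\<^sub>v (S *\<^sub>v c)"
      using X J S c by (simp flip: comm)
    also have "\<dots> = J *\<^sub>v ((X * S) *\<^sub>v c)"
      using X J(1) S(1) c by simp
    also have "\<dots> = 0\<^sub>v n"
      unfolding S(2) using J c by simp
    finally show "X *\<^sub>v (J *\<^sub>v (S *\<^sub>v c)) = 0\<^sub>v n" .
  qed (use J S c in \<open>auto intro!: mult_mat_vec_carrier\<close>)
  \<comment> \<open>On its own kernel \<open>X\<close> restricts to the zero matrix; only the size
    of that matrix matters here.\<close>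
  have "X * S = S * 0\<^sub>m d d"
    using S by simp
  then have "complexifiable d (0\<^sub>m d d)"
    by (rule complexifiable_restrict[OF X J comm S(1) zero_carrier_mat]) (auto intro: inj span[OF ker])
  then show ?thesis unfolding d_def by (rule even_if_complexifiable)
qed

lemma pow_char_matrix_commute:
  fixes B :: "'a :: field mat"
  assumes B: "B \<in> carrier_mat k k" and J: "J \<in> carrier_mat k k" "B * J = J * B"
  shows "char_matrix B a ^\<^sub>m i * J = J * char_matrix B a ^\<^sub>m i"
proof (induction i)
  case (Suc i)
  let ?C = "char_matrix B a"
  have C: "?C \<in> carrier_mat k k" using B by simp
  have "(- a \<cdot>\<^sub>m 1\<^sub>m k) * J = J * (- a \<cdot>\<^sub>m 1\<^sub>m k)"
    using J(1) mult_smult_distrib[OF J(1) one_carrier_mat] by (simp add: mult_smult_assoc_mat[of _ k k])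
  then have "?C * J = J * ?C"
    unfolding char_matrix_def using B J
    by (simp add: add_mult_distrib_mat[of _ k k] mult_add_distrib_mat[of _ k k])
  then have "?C ^\<^sub>m i * ?C * J = ?C ^\<^sub>m i * J * ?C"
    using C J by (simp add: assoc_mult_mat[of _ k k _ k _ k])
  with Suc C J show ?case by (simp add: assoc_mult_mat[of _ k k _ k _ k])
qed (use J carrier_matD(1)[OF char_matrix_closed[OF B]] in simp)

lemma even_dim_gen_eigenspace_if_complexifiable:
  assumes "complexifiable k B"
  shows "even (dim_gen_eigenspace B a i)"
proof -
  have "complexifiable k (char_matrix B a ^\<^sub>m i)"
    using assms pow_char_matrix_commute[of B k] unfolding complexifiable_def by auto
  then show ?thesis
    unfolding dim_gen_eigenspace_def by (rule even_kernel_dim_if_complexifiable)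
qed

text \<open>Kernel vectors with first coordinate 0 form the kernel of \<open>B\<close>; the first
  coordinate is a linear form, so the full kernel is larger by at most one dimension.\<close>

lemma kernel_dim_bordered_mat:
  assumes v: "v \<in> carrier_vec k" and B: "B \<in> carrier_mat k k"
  shows "kernel_dim (bordered_mat c v B) =
    kernel_dim B + (if \<exists>x \<in> mat_kernel (bordered_mat c v B). x $ 0 \<noteq> 0 then 1 else 0)"
proof (cases "\<exists>x \<in> mat_kernel (bordered_mat c v B). x $ 0 \<noteq> 0")
  case True
  let ?A = "bordered_mat c v B"
  have A: "?A \<in> carrier_mat (Suc k) (Suc k)" using B by simp
  from True obtain x w where w: "w \<in> carrier_vec k" and ker: "?A *\<^sub>v vCons x w = 0\<^sub>v (Suc k)" and x: "x \<noteq> 0"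
    by (metis A carrier_vec_SucE mat_kernelD vec_index_vCons_0)
  then have c: "c = 0" and w0: "x \<cdot>\<^sub>v v + B *\<^sub>v w = 0\<^sub>v k"
    using v B by (simp_all add: bordered_mat_mult_vCons zero_vec_Suc)
  \<comment> \<open>\<open>?T\<close> replaces the first basis vector by the kernel vector found
    above, which clears the first column of \<open>?A\<close>; \<open>?U\<close> is its
    inverse.\<close>
  let ?T = "bordered_mat x w (1\<^sub>m k)"
  let ?U = "bordered_mat (1 / x) ((- 1 / x) \<cdot>\<^sub>v w) (1\<^sub>m k)"
  have one: "bordered_mat 1 (0\<^sub>v k) (1\<^sub>m k) = 1\<^sub>m (Suc k)"
    by (rule bordered_mat_eqI[symmetric]) (auto intro!: eq_vecI simp: vec_index_vCons)
  have TU: "?T * ?U = 1\<^sub>m (Suc k)"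
  proof -
    have "(1 / x) \<cdot>\<^sub>v w + 1\<^sub>m k *\<^sub>v ((- 1 / x) \<cdot>\<^sub>v w) = 0\<^sub>v k"
      using w by (intro eq_vecI) auto
    then show ?thesis using w x by (simp add: bordered_mat_mult one)
  qed
  have "kernel_dim (?A * ?T) = kernel_dim ?A"
    using mat_kernel_dim_mult_eq_right[OF A _ _ TU] w v B A by (simp add: kernel_dim_def)
  moreover have "?A * ?T = four_block_mat (0\<^sub>m 1 1) (0\<^sub>m 1 k) (0\<^sub>m k 1) B"
  proof -
    have "?A * ?T = bordered_mat 0 (0\<^sub>v k) B"
      using v B w by (simp add: bordered_mat_mult c w0)
    also have "\<dots> = four_block_mat (0\<^sub>m 1 1) (0\<^sub>m 1 k) (0\<^sub>m k 1) B"
      unfolding bordered_mat_def using B by (intro eq_matI) auto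
    finally show ?thesis .
  qed
  ultimately have "kernel_dim ?A = 1 + kernel_dim B"
    using kernel_dim_four_block[of "0\<^sub>m 1 1 :: real mat" 1 B k] B by simp
  with True show ?thesis by simp
next
  case False
  let ?A = "bordered_mat c v B"
  let ?D = "four_block_mat (1\<^sub>m 1) (0\<^sub>m 1 k) (0\<^sub>m k 1) B"
  have A: "?A \<in> carrier_mat (Suc k) (Suc k)" using B by simp
  have D: "?D = bordered_mat 1 (0\<^sub>v k) B"
    unfolding bordered_mat_def using B by (intro eq_matI) auto
  \<comment> \<open>All kernel vectors have first coordinate 0, so the first column can be exchanged
    for that of the identity without changing the kernel.\<close>
  have "mat_kernel ?A = mat_kernel ?D"
  proof (intro subset_antisym subsetI)
    fix z assume z: "z \<in> mat_kernel ?A"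
    with A obtain x w where w: "w \<in> carrier_vec k" "z = vCons x w"
      by (metis carrier_vec_SucE mat_kernelD(1))
    with False z have "x = 0" by auto
    with z w v B A show "z \<in> mat_kernel ?D"
      unfolding D by (auto simp: mat_kernel[of _ "Suc k" "Suc k"] bordered_mat_mult_vCons[of _ k])
  next
    fix z assume z: "z \<in> mat_kernel ?D"
    then have z': "z \<in> carrier_vec (Suc k)" "?D *\<^sub>v z = 0\<^sub>v (Suc k)"
      using B unfolding D by (auto simp: mat_kernel[of _ "Suc k" "Suc k"])
    then obtain x w where w: "w \<in> carrier_vec k" "z = vCons x w"
      by (metis carrier_vec_SucE)
    with z' B have "x = 0" "B *\<^sub>v w = 0\<^sub>v k"
      unfolding D by (auto simp: bordered_mat_mult_vCons[of _ k] zero_vec_Suc mult_mat_vec_carrier)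
    with w v B A show "z \<in> mat_kernel ?A"
      by (auto simp: mat_kernel[of _ "Suc k" "Suc k"] bordered_mat_mult_vCons[of _ k] zero_vec_Suc)
  qed
  then have "kernel_dim ?A = kernel_dim ?D"
    using A B by (intro kernel_dim_eq_if_mat_kernel_eq[of _ "Suc k" "Suc k" _ "Suc k"]) (auto simp: D)
  with False kernel_dim_four_block[of "1\<^sub>m 1 :: real mat" 1 B k] B show ?thesis by simp
qed

lemma pow_mat_add:
  "A \<in> carrier_mat n n \<Longrightarrow> A ^\<^sub>m (i + j) = A ^\<^sub>m i * A ^\<^sub>m j"
  by (induction j) (simp_all add: assoc_mult_mat[of _ n n _ n _ n])

text \<open>
  The generalized eigenspaces of \<open>B\<close> have even dimension, and bordering adds at most one to it, so an
  odd dimension shows that some kernel vector lies outside the hyperplane.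
\<close>

lemma dim_gen_eigenspace_bordered_mat:
  assumes v: "v \<in> carrier_vec k" and B: "complexifiable k B" and a: "odd (dim_gen_eigenspace (bordered_mat c v B) a i)"
  shows "c = a" "i \<le> j \<Longrightarrow> odd (dim_gen_eigenspace (bordered_mat c v B) a j)"
proof -
  have Bc: "B \<in> carrier_mat k k" using B by (auto simp: complexifiable_def)
  let ?A = "\<lambda>i. bordered_mat (c - a) v (char_matrix B a) ^\<^sub>m i"
  have A: "?A i \<in> carrier_mat (Suc k) (Suc k)" for i
    using Bc by (intro pow_carrier_mat) simp
  have pow: "\<exists>v' \<in> carrier_vec k. ?A i = bordered_mat ((c - a) ^ i) v' (char_matrix B a ^\<^sub>m i)" for i
    using v Bc by (intro pow_bordered_mat) auto
  have odd_iff: "odd (dim_gen_eigenspace (bordered_mat c v B) a i) \<longleftrightarrow> (\<exists>x \<in> mat_kernel (?A i). x $ 0 \<noteq> 0)" for i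
  proof -
    obtain v' where v': "v' \<in> carrier_vec k" "?A i = bordered_mat ((c - a) ^ i) v' (char_matrix B a ^\<^sub>m i)"
      using pow by blast
    have "kernel_dim (?A i) = dim_gen_eigenspace B a i + (if \<exists>x \<in> mat_kernel (?A i). x $ 0 \<noteq> 0 then 1 else 0)"
      unfolding v'(2) dim_gen_eigenspace_def using v' Bc by (intro kernel_dim_bordered_mat) auto
    moreover have "even (dim_gen_eigenspace B a i)"
      by (rule even_dim_gen_eigenspace_if_complexifiable[OF B])
    moreover have "dim_gen_eigenspace (bordered_mat c v B) a i = kernel_dim (?A i)"
      using v Bc by (simp add: dim_gen_eigenspace_def char_matrix_bordered_mat)
    ultimately show ?thesis by simp
  qed
  from a odd_iff obtain x where x: "x \<in> mat_kernel (?A i)" "x $ 0 \<noteq> 0" by auto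
  show "c = a"
  proof -
    obtain v' where v': "v' \<in> carrier_vec k" "?A i = bordered_mat ((c - a) ^ i) v' (char_matrix B a ^\<^sub>m i)"
      using pow by blast
    obtain y w where w: "w \<in> carrier_vec k" "x = vCons y w"
      using x A by (metis carrier_vec_SucE mat_kernelD(1))
    have "?A i *\<^sub>v x = 0\<^sub>v (Suc k)" using x A by (metis mat_kernelD(2))
    moreover have "bordered_mat ((c - a) ^ i) v' (char_matrix B a ^\<^sub>m i) *\<^sub>v vCons y w =
        vCons ((c - a) ^ i * y) (y \<cdot>\<^sub>v v' + (char_matrix B a ^\<^sub>m i) *\<^sub>v w)"
      using v' Bc w by (intro bordered_mat_mult_vCons) auto
    ultimately have "(c - a) ^ i * y = 0"
      using v' w by (simp add: zero_vec_Suc)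
    with x w show ?thesis by simp
  qed
  assume "i \<le> j"
  then obtain l where j: "j = l + i" by (metis le_iff_add add.commute)
  \<comment> \<open>Kernels of powers increase, so the same vector outside the hyperplane serves as
    witness for \<open>j\<close>.\<close>
  have "?A j = ?A l * ?A i"
    unfolding j using Bc by (intro pow_mat_add[of _ "Suc k"]) simp
  then have "x \<in> mat_kernel (?A j)"
    using x mat_kernel_mult_subset[OF A[of i] A[of l]] by auto
  with x odd_iff show "odd (dim_gen_eigenspace (bordered_mat c v B) a j)" by auto
qed

section \<open>Jordan types\<close>

text \<open>The function \<open>f\<close> gives the dimensions of the kernels of (A - b)^k: a block
  of size n contributes min k n, and each of the \<open>t\<close> scalar entries is a block of size
  1.\<close>

lemma complex_type_if_odd_upward_closed:
  fixes ns ps :: "nat list" and t :: nat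
  defines "f \<equiv> \<lambda>k. (\<Sum>i<length ns. ps ! i * min k (ns ! i)) + t * min k 1"
  assumes type: "is_jordan_type m (Block_Type ns ps t)"
    and up: "\<And>i j. odd (f i) \<Longrightarrow> i \<le> j \<Longrightarrow> odd (f j)"
    and odd: "odd (f K)"
  shows "is_complex_type (Block_Type ns ps t)"
proof -
  define k where "k = length ns"
  from type have len: "k \<ge> 1" and ge2: "\<And>i. i < k \<Longrightarrow> ns ! i \<ge> 2"
    and desc: "\<And>i j. i < j \<Longrightarrow> j < k \<Longrightarrow> ns ! i > ns ! j"
    by (auto simp: k_def sorted_wrt_iff_nth_less)
  have inj: "i = j" if "ns ! i = ns ! j" "i < k" "j < k" for i j
    using that desc[of i j] desc[of j i] by (cases i j rule: linorder_cases) auto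
  define r where "r = (LEAST i. odd (f i))"
  have r: "odd (f i) \<longleftrightarrow> r \<le> i" for i
    using up LeastI[of "\<lambda>i. odd (f i)", OF odd] Least_le[of "\<lambda>i. odd (f i)" i] unfolding r_def by blast
  have "f 0 = 0" by (simp add: f_def)
  with r[of 0] have r0: "r > 0" by auto
  define mult where "mult i = (\<Sum>j<k. if ns ! j = i then ps ! j else 0) + (if i = 1 then t else 0)" for i
  \<comment> \<open>the number of blocks of size \<open>i\<close> is the negative second difference of \<open>f\<close>\<close>
  have second_diff: "f (i + 1) + f (i - 1) + mult i = 2 * f i" if i1: "i \<ge> 1" for i
  proof -
    have "p * min (i + 1) n + p * min (i - 1) n + (if n = i then p else 0) = 2 * (p * min i n)" for p n
    proof -
      obtain i' where i': "i = Suc i'" using i1 by (cases i) auto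
      consider "n < i" | "n = i" | "n > i" by linarith
      then show ?thesis unfolding i' by cases (auto simp: min_def algebra_simps)
    qed
    then have "(\<Sum>j<k. ps ! j * min (i + 1) (ns ! j)) + (\<Sum>j<k. ps ! j * min (i - 1) (ns ! j)) +
        (\<Sum>j<k. if ns ! j = i then ps ! j else 0) = 2 * (\<Sum>j<k. ps ! j * min i (ns ! j))"
      by (simp only: sum_distrib_left flip: sum.distrib)
    moreover have "t * min (i + 1) 1 + t * min (i - 1) 1 + (if i = 1 then t else 0) = 2 * (t * min i 1)"
      using that by (cases "i = 1") auto
    moreover have "a1 + a2 + (b1 + b2) + (c1 + c2) = 2 * (d1 + d2)"
      if "a1 + b1 + c1 = 2 * d1" "a2 + b2 + c2 = 2 * d2" for a1 b1 c1 d1 a2 b2 c2 d2 :: nat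
      using that by (simp add: distrib_left)
    ultimately show ?thesis unfolding f_def mult_def k_def by blast
  qed
  have mult_odd: "odd (mult i) \<longleftrightarrow> r = i \<or> r = i + 1" if "i \<ge> 1" for i
  proof -
    have "even (f (i + 1) + f (i - 1) + mult i)" unfolding second_diff[OF that] by simp
    \<comment> \<open>The values at i + 1 and i - 1 have different parity exactly if the threshold
      satisfies i - 1 < r \<le> i + 1.\<close>
    then have "odd (mult i) \<longleftrightarrow> odd (f (i + 1)) \<noteq> odd (f (i - 1))" by auto
    then have "odd (mult i) \<longleftrightarrow> (r \<le> i + 1) \<noteq> (r \<le> i - 1)" unfolding r .
    with that show ?thesis by (cases i) auto
  qed
  have mult_ns: "mult (ns ! i) = ps ! i" if "i < k" for i
  proof -
    have "(\<Sum>j<k. if ns ! j = ns ! i then ps ! j else 0) = (\<Sum>j<k. if j = i then ps ! j else 0)"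
      using inj[OF _ _ that] by (intro sum.cong) auto
    also have "\<dots> = ps ! i" using that by simp
    finally show ?thesis using ge2[OF that] unfolding mult_def by simp
  qed
  have mult_1: "mult 1 = t"
  proof -
    have "(\<Sum>j<k. if ns ! j = 1 then ps ! j else 0) = 0"
      using ge2 by (intro sum.neutral) force
    then show ?thesis by (simp add: mult_def)
  qed
  have mem: "\<exists>i<k. ns ! i = n" if "odd (mult n)" "n \<ge> 2" for n
  proof (rule ccontr)
    assume "\<not> ?thesis"
    then have "(\<Sum>j<k. if ns ! j = n then ps ! j else 0) = 0"
      by (intro sum.neutral) auto
    with that show False by (simp add: mult_def)
  qed
  have t: "odd t \<longleftrightarrow> r = 1 \<or> r = 2" using mult_odd[of 1] mult_1 by (simp add: numeral_2_eq_2)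
  have ps: "odd (ps ! i) \<longleftrightarrow> r = ns ! i \<or> r = ns ! i + 1" if "i < k" for i
    using mult_odd[of "ns ! i"] mult_ns[OF that] ge2[OF that] by simp
  consider "r = 1" | "r = 2" | "r \<ge> 3" using r0 by linarith
  then show ?thesis
  proof cases
    case 1
    have "even (ps ! i)" if "i < k" for i
      using ps[OF that] ge2[OF that] 1 by auto
    with t 1 show ?thesis by (simp add: k_def Let_def)
  next
    case 2
    then obtain i where i: "i < k" "ns ! i = 2"
      using mem[of 2] mult_odd[of 2] by auto
    have last: "i = k - 1"
    proof (rule ccontr)
      assume "i \<noteq> k - 1"
      with i have "ns ! (k - 1) < 2" using desc[of i "k - 1"] by simp
      with ge2[of "k - 1"] len show False by simp
    qed
    have "even (ps ! j)" if "j < k - 1" for j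
      using ps[of j] desc[of j i] that i last 2 by auto
    moreover have "odd (ps ! (k - 1))" using ps[OF i(1)] i 2 last by simp
    ultimately show ?thesis using t 2 i last by (simp add: k_def Let_def)
  next
    case 3
    obtain i where i: "i < k" "ns ! i = r"
      using mem[of r] mult_odd[of r] 3 by auto
    \<comment> \<open>Sizes r and r - 1 both occur with odd multiplicity. Since sizes strictly
      decrease along the list, their positions are adjacent, and the position of the smaller one is
      the index required by \<open>is_complex_type\<close>.\<close>
    have r1: "r - 1 \<ge> 2" "r - 1 \<ge> 1" "r = r - 1 + 1" using 3 by arith+
    then have "odd (mult (r - 1))" using mult_odd[of "r - 1"] by blast
    then obtain l where l: "l < k" "ns ! l = r - 1"
      using mem[of "r - 1"] r1 by blast
    have il: "i < l"
      using desc[of l i] i l 3 by (cases i l rule: linorder_cases) auto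
    have "l = i + 1"
    proof (rule ccontr)
      assume "l \<noteq> i + 1"
      with il have "i + 1 < l" by simp
      with desc[of i "i + 1"] desc[of "i + 1" l] i l 3 show False by simp
    qed
    moreover have "even (ps ! j)" if "j < k" "j \<notin> {i, l}" for j
      using ps[of j] inj[of j i] inj[of j l] that i l by auto
    moreover have "odd (ps ! i)" "odd (ps ! l)"
      using ps[of i] ps[of l] i l 3 by auto
    moreover have "even t" using t 3 by auto
    ultimately show ?thesis
      using i l 3 by (auto simp: k_def Let_def intro!: exI[of _ l])
  qed
qed

section \<open>Generalized eigenspaces of a matrix of given Jordan type\<close>

lemma sum_mult_flip:
  fixes n :: nat and g :: "nat \<Rightarrow> 'a :: semiring_1"
  assumes "i < n"
  shows "(\<Sum>k<n. (if i + k + 1 = n then 1 else 0) * g k) = g (n - 1 - i)"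
proof -
  have "(\<Sum>k<n. (if i + k + 1 = n then 1 else 0) * g k) = (\<Sum>k<n. if k = n - 1 - i then g k else 0)"
    using assms by (intro sum.cong) auto
  with assms show ?thesis by simp
qed

text \<open>Reversing the order of the basis moves the ones to the other side of the diagonal; the
  reversal \<open>P\<close> is its own inverse.\<close>

lemma similar_lower_jordan_block: "similar_mat (lower_jordan_block n b) (jordan_block n b)"
proof -
  define P where "P = mat n n (\<lambda>(i, j). if i + j + 1 = n then 1 else 0 :: real)"
  have P: "P \<in> carrier_mat n n" by (simp add: P_def)
  have left: "(P * X) $$ (i, j) = X $$ (n - 1 - i, j)" if "X \<in> carrier_mat n n" "i < n" "j < n" for X i j
    using that sum_mult_flip[of i n "\<lambda>k. X $$ (k, j)"]
    by (simp add: P_def scalar_prod_def atLeast0LessThan)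
  have right: "(X * P) $$ (i, j) = X $$ (i, n - 1 - j)" if "X \<in> carrier_mat n n" "i < n" "j < n" for X i j
    using that sum_mult_flip[of j n "\<lambda>k. X $$ (i, k)"]
    by (simp add: P_def scalar_prod_def atLeast0LessThan mult.commute add.commute)
  have "P * P = 1\<^sub>m n"
    using P by (intro eq_matI) (auto simp: left simp del: index_mult_mat(1), auto simp: P_def)
  moreover have "lower_jordan_block n b = P * jordan_block n b * P"
    using P by (intro eq_matI)
      (auto simp: right left lower_jordan_block_def simp del: index_mult_mat(1))
  ultimately show ?thesis
    using P by (intro similar_matI[of _ _ P P n]) (auto simp: lower_jordan_block_def)
qed

lemma lower_jordan_block_carrier [simp]: "lower_jordan_block n b \<in> carrier_mat n n"
  by (simp add: lower_jordan_block_def)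

lemma dim_lower_jordan_block [simp]:
  "dim_row (lower_jordan_block n b) = n" "dim_col (lower_jordan_block n b) = n"
  by (simp_all add: lower_jordan_block_def)

lemma char_matrix_four_block:
  assumes "A \<in> carrier_mat n n" "B \<in> carrier_mat m m"
  shows "char_matrix (four_block_mat A (0\<^sub>m n m) (0\<^sub>m m n) B) e =
    four_block_mat (char_matrix A e) (0\<^sub>m n m) (0\<^sub>m m n) (char_matrix B e)"
  unfolding char_matrix_def using assms by (intro eq_matI) auto

lemma dim_gen_eigenspace_four_block:
  assumes "A \<in> carrier_mat n n" "B \<in> carrier_mat m m"
  shows "dim_gen_eigenspace (four_block_mat A (0\<^sub>m n m) (0\<^sub>m m n) B) e k =
    dim_gen_eigenspace A e k + dim_gen_eigenspace B e k"
  unfolding dim_gen_eigenspace_def char_matrix_four_block[OF assms]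
  using assms by (subst pow_four_block_mat[of _ n _ m]) (auto intro!: kernel_dim_four_block)

lemma dim_gen_eigenspace_diag_block_mat:
  assumes "\<And>A. A \<in> set As \<Longrightarrow> square_mat A"
  shows "dim_gen_eigenspace (diag_block_mat As) e k = (\<Sum>A\<leftarrow>As. dim_gen_eigenspace A e k)"
  using assms
proof (induction As)
  case Nil
  have "diag_block_mat [] = (1\<^sub>m 0 :: 'a mat)" by (intro eq_matI) auto
  moreover have "char_matrix (1\<^sub>m 0 :: 'a mat) e ^\<^sub>m k = 1\<^sub>m 0"
    by (intro eq_matI) (auto simp: char_matrix_def)
  ultimately show ?case by (simp add: dim_gen_eigenspace_def)
next
  case (Cons A As)
  let ?D = "diag_block_mat As"
  from Cons.prems have sq: "dim_col A = dim_row A" "dim_col ?D = dim_row ?D"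
    using diag_block_mat_square[of As] by auto
  then have "A \<in> carrier_mat (dim_row A) (dim_row A)" "?D \<in> carrier_mat (dim_row ?D) (dim_row ?D)"
    by (metis carrier_matI)+
  note dim_gen_eigenspace_four_block[OF this, of e k]
  moreover have "dim_gen_eigenspace ?D e k = (\<Sum>A\<leftarrow>As. dim_gen_eigenspace A e k)"
    using Cons.prems by (intro Cons.IH) simp
  ultimately show ?case by (simp only: diag_block_mat.simps Let_def sq list.map sum_list.Cons)
qed

lemma dim_gen_eigenspace_lower_jordan_block:
  "dim_gen_eigenspace (lower_jordan_block n b) b k = min k n"
proof -
  have "jordan_matrix [(n, b)] = jordan_block n b"
    by (simp add: jordan_matrix_def del: diag_block_mat.simps)
  then show ?thesis
    using dim_gen_eigenspace_jordan_matrix[of "[(n, b)]" b k]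
    by (simp add: dim_gen_eigenspace_similar[OF similar_lower_jordan_block])
qed

lemma dim_gen_eigenspace_scalar_mat:
  "dim_gen_eigenspace (b \<cdot>\<^sub>m 1\<^sub>m t) b k = t * min k 1"
proof (cases k)
  case 0
  then show ?thesis by (simp add: dim_gen_eigenspace_def char_matrix_def)
next
  case (Suc l)
  have "char_matrix (b \<cdot>\<^sub>m 1\<^sub>m t) b = 0\<^sub>m t t"
    by (intro eq_matI) (auto simp: char_matrix_def)
  then show ?thesis
    using Suc by (simp add: dim_gen_eigenspace_def)
qed

lemma dim_gen_eigenspace_jordan_type:
  assumes "length ps = length ns" "has_jordan_type A b (Block_Type ns ps t)"
  shows "dim_gen_eigenspace A b k = (\<Sum>i<length ns. ps ! i * min k (ns ! i)) + t * min k 1"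
proof -
  let ?bl = "concat (map2 (\<lambda>n p. replicate p (lower_jordan_block n b)) ns ps)"
  have "dim_gen_eigenspace A b k = dim_gen_eigenspace (diag_block_mat (?bl @ [b \<cdot>\<^sub>m 1\<^sub>m t])) b k"
    using dim_gen_eigenspace_similar[OF assms(2)[unfolded has_jordan_type.simps]] by simp
  also have "\<dots> = (\<Sum>A\<leftarrow>?bl. dim_gen_eigenspace A b k) + t * min k 1"
    by (subst dim_gen_eigenspace_diag_block_mat) (auto simp: dim_gen_eigenspace_scalar_mat)
  also have "(\<Sum>A\<leftarrow>?bl. dim_gen_eigenspace A b k) = (\<Sum>i<length ns. ps ! i * min k (ns ! i))"
    using assms(1)[symmetric]
  proof (induction ns ps rule: list_induct2)
    case (Cons n ns p ps)
    then show ?case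
      by (simp add: dim_gen_eigenspace_lower_jordan_block sum_list_replicate sum.lessThan_Suc_shift del: sum.lessThan_Suc)
  qed simp
  finally show ?thesis .
qed

text \<open>Once the exponent exceeds all block sizes, the generalized eigenspace is the whole
  space, of odd dimension \<open>m\<close>. Adding 1 to the sum of the sizes also makes the scalar
  part count fully.\<close>

lemma ex_odd_dim_gen_eigenspace:
  assumes "is_jordan_type m l" "odd m" "has_jordan_type A b l"
  shows "\<exists>k. odd (dim_gen_eigenspace A b k)"
proof (cases l)
  case (Scalar_Type m')
  with assms dim_gen_eigenspace_scalar_mat[of b m 1] show ?thesis by (intro exI[of _ 1]) simp
next
  case (Block_Type ns ps t)
  define k where "k = sum_list ns + 1"
  have "(\<Sum>i<length ns. ps ! i * min k (ns ! i)) = (\<Sum>i<length ns. ns ! i * ps ! i)"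
  proof (rule sum.cong)
    fix i assume "i \<in> {..<length ns}"
    then have "ns ! i \<le> k" unfolding k_def by (simp add: elem_le_sum_list le_SucI)
    then show "ps ! i * min k (ns ! i) = ns ! i * ps ! i" by simp
  qed simp
  then have "dim_gen_eigenspace A b k = m"
    using assms(1) dim_gen_eigenspace_jordan_type[OF _ assms(3)[unfolded Block_Type], of k] Block_Type
    by (simp add: k_def)
  with assms show ?thesis by metis
qed

section \<open>Invariant hyperplanes for complex types\<close>

definition complexifiable_blocks :: "real mat list \<Rightarrow> bool" where
  "complexifiable_blocks As \<longleftrightarrow> (\<exists>k. complexifiable k (diag_block_mat As))"

text \<open>Quantifying over the size allows lists of blocks to be split and joined without tracking
  dimensions.\<close>

definition hyperplane_complexifiable_blocks :: "real mat list \<Rightarrow> bool" where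
  "hyperplane_complexifiable_blocks As \<longleftrightarrow>
     (\<exists>k. diag_block_mat As \<in> carrier_mat (Suc k) (Suc k) \<and> hyperplane_complexifiable k (diag_block_mat As))"

lemma complexifiable_blocks_append:
  assumes "complexifiable_blocks As" "complexifiable_blocks Bs"
  shows "complexifiable_blocks (As @ Bs)"
proof -
  from assms obtain k l where k: "complexifiable k (diag_block_mat As)" and l: "complexifiable l (diag_block_mat Bs)"
    unfolding complexifiable_blocks_def by auto
  then have "dim_row (diag_block_mat As) = k" "dim_col (diag_block_mat As) = k"
    "dim_row (diag_block_mat Bs) = l" "dim_col (diag_block_mat Bs) = l"
    unfolding complexifiable_def by auto
  with complexifiable_four_block[OF k l] show ?thesis
    unfolding complexifiable_blocks_def diag_block_mat_append Let_def by metis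
qed

text \<open>Both orders are provided because the blocks that carry the hyperplane may stand in the
  middle of the list.\<close>

lemma hyperplane_complexifiable_blocks_append:
  assumes "hyperplane_complexifiable_blocks As" "complexifiable_blocks Bs"
  shows "hyperplane_complexifiable_blocks (As @ Bs)" "hyperplane_complexifiable_blocks (Bs @ As)"
proof -
  from assms obtain k l where A: "diag_block_mat As \<in> carrier_mat (Suc k) (Suc k)"
    and k: "hyperplane_complexifiable k (diag_block_mat As)" and l: "complexifiable l (diag_block_mat Bs)"
    unfolding complexifiable_blocks_def hyperplane_complexifiable_blocks_def by auto
  then have B: "diag_block_mat Bs \<in> carrier_mat l l"
    unfolding complexifiable_def by auto
  have dims: "dim_row (diag_block_mat As) = Suc k" "dim_col (diag_block_mat As) = Suc k"
    "dim_row (diag_block_mat Bs) = l" "dim_col (diag_block_mat Bs) = l"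
    using A B by auto
  show "hyperplane_complexifiable_blocks (As @ Bs)"
    unfolding hyperplane_complexifiable_blocks_def diag_block_mat_append Let_def dims
    using hyperplane_complexifiable_four_block[OF A k l] four_block_carrier_mat[OF A B]
    by (intro exI[of _ "k + l"]) simp
  show "hyperplane_complexifiable_blocks (Bs @ As)"
    unfolding hyperplane_complexifiable_blocks_def diag_block_mat_append Let_def dims
    using hyperplane_complexifiable_four_block'[OF A k l] four_block_carrier_mat[OF B A]
    by (intro exI[of _ "k + l"]) (simp add: add.commute)
qed

lemma complexifiable_blocks_Nil: "complexifiable_blocks []"
  unfolding complexifiable_blocks_def complexifiable_def
  by (intro exI[of _ 0] conjI bexI[of _ "0\<^sub>m 0 0"]) (auto intro!: eq_matI)

lemma diag_block_mat_pair:
  "diag_block_mat [A, B] = four_block_mat A (0\<^sub>m (dim_row A) (dim_col B)) (0\<^sub>m (dim_row B) (dim_col A)) B"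
  using diag_block_mat_append[of "[A]" "[B]"]
  by (simp only: append_Cons append_Nil diag_block_mat_singleton Let_def)

lemma complexifiable_blocks_pair:
  assumes "B \<in> carrier_mat n n"
  shows "complexifiable_blocks [B, B]"
  using complexifiable_double[OF assms] assms
  unfolding complexifiable_blocks_def by (intro exI[of _ "n + n"]) (simp add: diag_block_mat_pair del: diag_block_mat.simps)

lemma complexifiable_blocks_replicate:
  assumes B: "B \<in> carrier_mat n n" and "even p"
  shows "complexifiable_blocks (replicate p B)"
proof -
  from assms obtain q where "p = 2 * q" by auto
  moreover have "complexifiable_blocks (replicate (2 * q) B)"
  proof (induction q)
    case (Suc q)
    have "replicate (2 * Suc q) B = [B, B] @ replicate (2 * q) B" by simp
    with Suc complexifiable_blocks_append[OF complexifiable_blocks_pair[OF B]] show ?case by metis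
  qed (simp add: complexifiable_blocks_Nil)
  ultimately show ?thesis by simp
qed

lemma complexifiable_scalar_mat:
  assumes "even k"
  shows "complexifiable k (b \<cdot>\<^sub>m 1\<^sub>m k)"
proof -
  from assms obtain h where h: "k = h + h" by (metis evenE mult_2)
  have "b \<cdot>\<^sub>m 1\<^sub>m k = four_block_mat (b \<cdot>\<^sub>m 1\<^sub>m h) (0\<^sub>m h h) (0\<^sub>m h h) (b \<cdot>\<^sub>m 1\<^sub>m h)"
    unfolding h by (intro eq_matI) auto
  with complexifiable_double[of "b \<cdot>\<^sub>m 1\<^sub>m h" h] h show ?thesis by simp
qed

lemma complexifiable_blocks_scalar_mat:
  "even k \<Longrightarrow> complexifiable_blocks [b \<cdot>\<^sub>m 1\<^sub>m k]"
  unfolding complexifiable_blocks_def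
  by (intro exI[of _ k]) (simp only: diag_block_mat_singleton complexifiable_scalar_mat)

lemma hyperplane_complexifiable_scalar_mat:
  assumes "even k"
  shows "hyperplane_complexifiable k (b \<cdot>\<^sub>m 1\<^sub>m (Suc k))"
proof -
  have "b \<cdot>\<^sub>m 1\<^sub>m (Suc k) = bordered_mat b (0\<^sub>v k) (b \<cdot>\<^sub>m 1\<^sub>m k)"
    unfolding bordered_mat_def by (intro eq_matI) auto
  then show ?thesis
    unfolding hyperplane_complexifiable_def using complexifiable_scalar_mat[OF assms, of b]
    by (metis similar_mat_refl smult_carrier_mat one_carrier_mat zero_carrier_vec)
qed

lemma hyperplane_complexifiable_blocks_scalar_mat:
  assumes "odd t"
  shows "hyperplane_complexifiable_blocks [b \<cdot>\<^sub>m 1\<^sub>m t]"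
proof -
  from assms obtain k where "t = Suc k" "even k" by (cases t) auto
  then show ?thesis
    unfolding hyperplane_complexifiable_blocks_def
    using hyperplane_complexifiable_scalar_mat[of k b]
    by (intro exI[of _ k]) (simp del: diag_block_mat.simps)
qed

text \<open>Removing the first basis vector of the larger block leaves two equal blocks.\<close>

lemma hyperplane_complexifiable_blocks_consecutive:
  "hyperplane_complexifiable_blocks [lower_jordan_block (Suc n) b, lower_jordan_block n b]"
proof -
  let ?L = "lower_jordan_block n b"
  let ?D = "diag_block_mat [lower_jordan_block (Suc n) b, ?L]"
  \<comment> \<open>The border column is the subdiagonal 1 of the larger block, which maps the
    removed basis vector to the first vector of the remaining one.\<close>
  have D: "?D = bordered_mat b (unit_vec n 0 @\<^sub>v 0\<^sub>v n) (four_block_mat ?L (0\<^sub>m n n) (0\<^sub>m n n) ?L)"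
    unfolding bordered_mat_def diag_block_mat_pair by (intro eq_matI) (auto simp: lower_jordan_block_def)
  have B: "complexifiable (n + n) (four_block_mat ?L (0\<^sub>m n n) (0\<^sub>m n n) ?L)"
    by (rule complexifiable_double) simp
  have carr: "?D \<in> carrier_mat (Suc (n + n)) (Suc (n + n))"
    unfolding D by (intro bordered_mat_carrier four_block_carrier_mat) simp_all
  have "similar_mat ?D (bordered_mat b (unit_vec n 0 @\<^sub>v 0\<^sub>v n) (four_block_mat ?L (0\<^sub>m n n) (0\<^sub>m n n) ?L))"
    using similar_mat_refl[OF carr] unfolding D .
  moreover have "unit_vec n 0 @\<^sub>v 0\<^sub>v n \<in> carrier_vec (n + n)" by simp
  ultimately have "hyperplane_complexifiable (n + n) ?D"
    unfolding hyperplane_complexifiable_def using B by blast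
  with carr show ?thesis
    unfolding hyperplane_complexifiable_blocks_def by blast
qed

text \<open>Splitting a block of size 1 off the scalar part lets sizes 2 and 1 be treated as
  consecutive block sizes.\<close>

lemma diag_block_mat_append_scalar_mat:
  "diag_block_mat (As @ [b \<cdot>\<^sub>m 1\<^sub>m (Suc k)]) = diag_block_mat (As @ [lower_jordan_block 1 b, b \<cdot>\<^sub>m 1\<^sub>m k])"
proof -
  have "diag_block_mat [b \<cdot>\<^sub>m 1\<^sub>m (Suc k)] = diag_block_mat [lower_jordan_block 1 b, b \<cdot>\<^sub>m 1\<^sub>m k]"
    unfolding diag_block_mat_pair diag_block_mat_singleton
    by (intro eq_matI) (auto simp: lower_jordan_block_def)
  then show ?thesis unfolding diag_block_mat_append by (simp only:)
qed

text \<open>Pairing each size with its multiplicity allows a type to be cut at a position of the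
  list.\<close>

definition jordan_blocks :: "real \<Rightarrow> (nat \<times> nat) list \<Rightarrow> real mat list" where
  "jordan_blocks b zs = concat (map (\<lambda>(n, p). replicate p (lower_jordan_block n b)) zs)"

lemma jordan_blocks_append [simp]: "jordan_blocks b (xs @ ys) = jordan_blocks b xs @ jordan_blocks b ys"
  by (simp add: jordan_blocks_def)

lemma jordan_blocks_Cons [simp]:
  "jordan_blocks b ((n, p) # ys) = replicate p (lower_jordan_block n b) @ jordan_blocks b ys"
  by (simp add: jordan_blocks_def)

lemma jordan_blocks_Nil [simp]: "jordan_blocks b [] = []"
  by (simp add: jordan_blocks_def)

lemma complexifiable_jordan_blocks:
  "(\<And>n p. (n, p) \<in> set zs \<Longrightarrow> even p) \<Longrightarrow> complexifiable_blocks (jordan_blocks b zs)"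
proof (induction zs)
  case (Cons z zs)
  obtain n p where z: "z = (n, p)" by force
  with Cons have "complexifiable_blocks (replicate p (lower_jordan_block n b))"
    by (intro complexifiable_blocks_replicate[of _ n]) auto
  with Cons z show ?case by (auto intro!: complexifiable_blocks_append)
qed (simp add: complexifiable_blocks_Nil)

text \<open>One block of each size forms the pair carrying the hyperplane; the remaining blocks of
  either size are even in number.\<close>

lemma hyperplane_complexifiable_consecutive_replicate:
  assumes "odd p" "odd q"
  shows "hyperplane_complexifiable_blocks
    (replicate p (lower_jordan_block (Suc n) b) @ replicate q (lower_jordan_block n b))"
proof -
  from assms obtain p' q' where p: "p = Suc p'" "even p'" and q: "q = Suc q'" "even q'"
    by (cases p; cases q) auto
  have "replicate p (lower_jordan_block (Suc n) b) @ replicate q (lower_jordan_block n b) =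
    replicate p' (lower_jordan_block (Suc n) b) @
    ([lower_jordan_block (Suc n) b, lower_jordan_block n b] @ replicate q' (lower_jordan_block n b))"
    unfolding p q by (simp add: replicate_append_same[symmetric])
  moreover have "complexifiable_blocks (replicate p' (lower_jordan_block (Suc n) b))"
    "complexifiable_blocks (replicate q' (lower_jordan_block n b))"
    using p q by (auto intro: complexifiable_blocks_replicate lower_jordan_block_carrier)
  ultimately show ?thesis
    using hyperplane_complexifiable_blocks_append hyperplane_complexifiable_blocks_consecutive by metis
qed

text \<open>Each family has one odd part that carries the hyperplane: the scalar part; a block of
  size 2 with a block of size 1 from the scalar part; or two blocks of consecutive sizes. Everything
  else occurs evenly.\<close>

lemma hyperplane_complexifiable_if_complex_type:
  assumes type: "is_jordan_type (Suc k) l" and "is_complex_type l" and "even k"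
    and A: "A \<in> carrier_mat (Suc k) (Suc k)" "has_jordan_type A b l"
  shows "hyperplane_complexifiable k A"
proof (cases l)
  case (Scalar_Type m)
  with assms hyperplane_complexifiable_scalar_mat show ?thesis by simp
next
  case (Block_Type ns ps t)
  let ?zs = "zip ns ps"
  let ?As = "jordan_blocks b ?zs @ [b \<cdot>\<^sub>m 1\<^sub>m t]"
  have len: "length ps = length ns" "ns \<noteq> []" using type Block_Type by auto
  have sim: "similar_mat A (diag_block_mat ?As)"
    using A Block_Type by (simp add: jordan_blocks_def)
  \<comment> \<open>The list \<open>Bs\<close> may differ from \<open>?As\<close> although the
    matrices agree: in the second family the scalar part is split.\<close>
  have blocks: "\<exists>Bs. diag_block_mat Bs = diag_block_mat ?As \<and> hyperplane_complexifiable_blocks Bs"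
  proof -
    from assms(2) Block_Type consider
      (a) "odd t" "\<And>i. i < length ns \<Longrightarrow> even (ps ! i)"
      | (b) "odd t" "\<And>i. i < length ns - 1 \<Longrightarrow> even (ps ! i)" "ns ! (length ns - 1) = 2" "odd (ps ! (length ns - 1))"
      | (c) l where "even t" "1 \<le> l" "l < length ns" "ns ! (l - 1) = ns ! l + 1" "odd (ps ! (l - 1))"
          "odd (ps ! l)" "\<And>i. i < length ns \<Longrightarrow> i \<noteq> l - 1 \<Longrightarrow> i \<noteq> l \<Longrightarrow> even (ps ! i)"
      by (auto simp: Let_def)
    then show ?thesis
    proof cases
      case a
      then have "complexifiable_blocks (jordan_blocks b ?zs)"
        using len by (intro complexifiable_jordan_blocks) (auto simp: set_zip)
      with hyperplane_complexifiable_blocks_append(2)[OF hyperplane_complexifiable_blocks_scalar_mat[OF a(1)]]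
      show ?thesis by blast
    next
      case b
      define xs where "xs = take (length ns - 1) ?zs"
      define p where "p = ps ! (length ns - 1)"
      have zs: "?zs = xs @ [(2, p)]"
        using len b take_Suc_conv_app_nth[of "length ns - 1" ?zs] by (simp add: xs_def p_def)
      obtain t' where t': "t = Suc t'" "even t'" using b(1) by (cases t) auto
      have "diag_block_mat ?As = diag_block_mat (jordan_blocks b ?zs @ [lower_jordan_block 1 b, b \<cdot>\<^sub>m 1\<^sub>m t'])"
        unfolding t' by (rule diag_block_mat_append_scalar_mat)
      moreover have "jordan_blocks b ?zs @ [lower_jordan_block 1 b, b \<cdot>\<^sub>m 1\<^sub>m t'] =
          jordan_blocks b xs @ ((replicate p (lower_jordan_block (Suc 1) b) @ replicate 1 (lower_jordan_block 1 b))
            @ [b \<cdot>\<^sub>m 1\<^sub>m t'])"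
        unfolding zs by (simp add: numeral_2_eq_2)
      moreover have "complexifiable_blocks (jordan_blocks b xs)"
        using len b(2) by (intro complexifiable_jordan_blocks) (auto simp: xs_def set_conv_nth)
      ultimately show ?thesis
        using hyperplane_complexifiable_consecutive_replicate[of p 1 1 b] b(4)
          hyperplane_complexifiable_blocks_append complexifiable_blocks_scalar_mat[OF t'(2), of b]
        by (metis odd_one p_def)
    next
      case c
      define xs ys where "xs = take (l - 1) ?zs" and "ys = drop (Suc l) ?zs"
      define p q n where "p = ps ! (l - 1)" and "q = ps ! l" and "n = ns ! l"
      have "?zs = xs @ ?zs ! (l - 1) # drop (Suc (l - 1)) ?zs"
        unfolding xs_def using c len by (intro id_take_nth_drop) simp
      moreover have "drop (Suc (l - 1)) ?zs = ?zs ! l # ys"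
        using c len Cons_nth_drop_Suc[of l ?zs] by (simp add: ys_def)
      ultimately have zs: "?zs = xs @ (Suc n, p) # (n, q) # ys"
        using c len by (simp add: p_def q_def n_def)
      have "?As = jordan_blocks b xs @ ((replicate p (lower_jordan_block (Suc n) b) @ replicate q (lower_jordan_block n b)) @
          (jordan_blocks b ys @ [b \<cdot>\<^sub>m 1\<^sub>m t]))"
        unfolding zs by simp
      moreover have "complexifiable_blocks (jordan_blocks b xs)"
        using len c by (intro complexifiable_jordan_blocks) (auto simp: xs_def set_conv_nth)
      moreover have "complexifiable_blocks (jordan_blocks b ys @ [b \<cdot>\<^sub>m 1\<^sub>m t])"
        using len c by (intro complexifiable_blocks_append complexifiable_jordan_blocks complexifiable_blocks_scalar_mat)
          (auto simp: ys_def set_conv_nth)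
      moreover have "hyperplane_complexifiable_blocks (replicate p (lower_jordan_block (Suc n) b) @ replicate q (lower_jordan_block n b))"
        using c by (intro hyperplane_complexifiable_consecutive_replicate) (auto simp: p_def q_def)
      ultimately show ?thesis
        using hyperplane_complexifiable_blocks_append by metis
    qed
  qed
  then obtain k' where "diag_block_mat ?As \<in> carrier_mat (Suc k') (Suc k')"
    "hyperplane_complexifiable k' (diag_block_mat ?As)"
    unfolding hyperplane_complexifiable_blocks_def by metis
  moreover have "diag_block_mat ?As \<in> carrier_mat (Suc k) (Suc k)"
    using similar_matD[OF sim] A(1) by auto
  ultimately have "hyperplane_complexifiable k (diag_block_mat ?As)"
    by (metis carrier_matD(1) nat.inject)
  with sim show ?thesis by (rule hyperplane_complexifiable_similar)
qed

section \<open>Existence of the Jordan type for a single real eigenvalue\<close>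

lemma poly_char_poly_of_real:
  assumes "A \<in> carrier_mat n n"
  shows "poly (char_poly (map_mat complex_of_real A)) (of_real x) = of_real (poly (char_poly A) x)"
  using assms by (simp add: of_real_hom.char_poly_hom of_real_hom.poly_map_poly)

text \<open>The spectrum is complex, so the polynomial is first split over the complex numbers,
  where every root is \<open>a\<close>; the identity then descends because the embedding of
  coefficients is injective.\<close>

lemma char_poly_if_single_eigenvalue:
  assumes A: "A \<in> carrier_mat m m" and spec: "spec A = {complex_of_real a}"
  shows "char_poly A = [:- a, 1:] ^ m"
proof -
  let ?C = "map_mat complex_of_real A"
  have C: "?C \<in> carrier_mat m m" using A by simp
  from char_poly_factorized[OF C] obtain as where as: "char_poly ?C = (\<Prod>b\<leftarrow>as. [:- b, 1:])" "length as = m"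
    by auto
  have "b = of_real a" if "b \<in> set as" for b
  proof -
    have "poly (char_poly ?C) b = 0"
      unfolding as(1) using that by (auto simp: poly_prod_list prod_list_zero_iff image_iff intro!: bexI[of _ b])
    then have "b \<in> spec A"
      using C by (simp add: spec_def spectrum_root_char_poly)
    with spec show ?thesis by simp
  qed
  then have "as = replicate m (of_real a)"
    using as(2) by (simp add: replicate_eqI)
  then have "map_poly complex_of_real (char_poly A) = [:- of_real a, 1:] ^ m"
    using as(1) A by (simp add: of_real_hom.char_poly_hom prod_list_replicate)
  also have "\<dots> = map_poly complex_of_real ([:- a, 1:] ^ m)"
  proof -
    interpret map_poly_comm_ring_hom complex_of_real ..
    show ?thesis by (simp add: hom_power)
  qed
  finally show ?thesis
    by (simp add: poly_eq_iff coeff_map_poly)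
qed

lemma jordan_nf_if_single_eigenvalue:
  assumes A: "A \<in> carrier_mat m m" and spec: "spec A = {complex_of_real a}"
  shows "\<exists>ss. (\<forall>s \<in> set ss. s > 0) \<and> sum_list ss = m \<and>
    similar_mat A (jordan_matrix (map (\<lambda>s. (s, a)) ss))"
proof -
  note cp = char_poly_if_single_eigenvalue[OF assms]
  have "char_poly A = (\<Prod>b\<leftarrow>replicate m a. [:- b, 1:])"
    by (simp add: cp prod_list_replicate)
  from jordan_nf_exists[OF A this] obtain n_as where jnf: "jordan_nf A n_as" by auto
  have "snd z = a \<and> fst z > 0" if "z \<in> set n_as" for z
  proof -
    have pos: "fst z > 0" using jnf that unfolding jordan_nf_def by (metis gr0I imageI)
    \<comment> \<open>A nonempty block contributes its eigenvalue as a root of the characteristic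
      polynomial, whose only root is \<open>a\<close>.\<close>
    have "[:- snd z, 1:] ^ fst z dvd char_poly A"
      unfolding jordan_nf_char_poly[OF jnf] using that by (intro prod_list_dvd) (auto simp: image_iff case_prod_beta intro!: bexI[of _ z])
    then have "[:- snd z, 1:] dvd [:- a, 1:] ^ m"
      using pos unfolding cp by (metis dvd_power dvd_trans)
    then have "poly ([:- a, 1:] ^ m) (snd z) = 0"
      by (simp only: poly_eq_0_iff_dvd)
    then show ?thesis using pos by simp
  qed
  then have "n_as = map (\<lambda>s. (s, a)) (map fst n_as)" "\<forall>s \<in> set (map fst n_as). s > 0"
    by (auto simp: map_idI comp_def prod_eq_iff intro!: map_idI[symmetric])
  moreover have sim: "similar_mat A (jordan_matrix n_as)"
    using jnf by (simp add: jordan_nf_def)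
  moreover have "sum_list (map fst n_as) = m"
    using similar_matD[OF sim] A by (metis carrier_matD(1) insert_subset jordan_matrix_dim(1))
  ultimately show ?thesis by metis
qed

lemma char_matrix_jordan_matrix_pow_eq_zero:
  fixes a :: "'a :: field"
  assumes "\<And>s. s \<in> set ss \<Longrightarrow> s \<le> k"
  shows "char_matrix (jordan_matrix (map (\<lambda>s. (s, a)) ss)) a ^\<^sub>m k = 0\<^sub>m (sum_list ss) (sum_list ss)"
  using assms
proof (induction ss)
  case Nil
  show ?case by (intro eq_matI) (auto simp: jordan_matrix_def char_matrix_def)
next
  case (Cons s ss)
  let ?n = "sum_list ss"
  let ?J = "jordan_matrix (map (\<lambda>s. (s, a)) ss)"
  have J: "?J \<in> carrier_mat ?n ?n"
    using jordan_matrix_carrier[of "map (\<lambda>s. (s, a)) ss"] by (simp add: comp_def)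
  have "jordan_block s 0 ^\<^sub>m k = (0\<^sub>m s s :: 'a mat)"
    unfolding jordan_block_zero_pow using Cons.prems[of s] by (intro eq_matI) auto
  moreover have "char_matrix ?J a ^\<^sub>m k = 0\<^sub>m ?n ?n"
    using Cons by simp
  moreover have "jordan_matrix (map (\<lambda>s. (s, a)) (s # ss)) =
      four_block_mat (jordan_block s a) (0\<^sub>m s ?n) (0\<^sub>m ?n s) ?J"
    by (simp add: jordan_matrix_Cons comp_def)
  ultimately show ?case
    using J by (simp add: char_matrix_four_block[of _ s _ ?n] pow_four_block_mat[of _ s _ ?n] char_matrix_jordan_block)
qed

text \<open>The block sizes sum to \<open>m\<close>, so none exceeds \<open>m\<close> and the
  \<open>m\<close>-th power annihilates each block.\<close>

lemma nilpotent_if_single_eigenvalue: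
  assumes A: "A \<in> carrier_mat m m" and spec: "spec A = {complex_of_real a}"
  shows "char_matrix A a ^\<^sub>m m = 0\<^sub>m m m"
proof -
  from jordan_nf_if_single_eigenvalue[OF assms] obtain ss where
    ss: "sum_list ss = m" and "similar_mat A (jordan_matrix (map (\<lambda>s. (s, a)) ss))"
    by auto
  then obtain P G where wit: "similar_mat_wit A (jordan_matrix (map (\<lambda>s. (s, a)) ss)) P G"
    unfolding similar_mat_def by auto
  have zero: "char_matrix (jordan_matrix (map (\<lambda>s. (s, a)) ss)) a ^\<^sub>m m = 0\<^sub>m m m"
    using char_matrix_jordan_matrix_pow_eq_zero[of ss m a] ss member_le_sum_list[of _ ss] by simp
  show ?thesis
    using similar_mat_wit_pow_id[OF similar_mat_wit_char_matrix[OF wit], of a m] similar_mat_witD2[OF A wit]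
    by (simp add: zero)
qed

text \<open>The head of the first list is located in the second one and moved to the front past the
  blocks preceding it, by a single swap of two diagonal blocks.\<close>

lemma similar_diag_block_mat_mset_eq:
  assumes "\<And>A. A \<in> set As \<Longrightarrow> square_mat (A :: 'a :: comm_ring_1 mat)" "mset As = mset Bs"
  shows "similar_mat (diag_block_mat As) (diag_block_mat Bs)"
  using assms
proof (induction As arbitrary: Bs)
  case Nil
  then show ?case by (auto intro!: similar_mat_refl[of _ 0])
next
  case (Cons A As)
  then have "A \<in> set Bs" by (metis list.set_intros(1) mset_eq_setD)
  then obtain Cs Ds where Bs: "Bs = Cs @ A # Ds" by (meson split_list)
  with Cons.prems(2) have mset: "mset As = mset (Cs @ Ds)" by simp
  have sqs: "square_mat B" if "B \<in> set Cs \<or> B \<in> set Ds" for B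
    using Cons.prems that Bs by (metis Un_iff list.set_intros(2) mset mset_eq_setD set_append)
  have sq: "square_mat A" "square_mat (diag_block_mat As)" "square_mat (diag_block_mat Cs)" "square_mat (diag_block_mat Ds)"
    using Cons.prems(1) sqs by (auto intro!: diag_block_mat_square simp del: square_mat.simps)
  define a c d where "a = dim_row A" and "c = dim_row (diag_block_mat Cs)" and "d = dim_row (diag_block_mat Ds)"
  have sim: "similar_mat (diag_block_mat As) (diag_block_mat (Cs @ Ds))"
    using Cons.prems(1) mset by (intro Cons.IH) auto
  have A: "A \<in> carrier_mat a a" and C: "diag_block_mat Cs \<in> carrier_mat c c" and D: "diag_block_mat Ds \<in> carrier_mat d d"
    using sq by (auto simp: a_def c_def d_def)
  have CD: "diag_block_mat (Cs @ Ds) = four_block_mat (diag_block_mat Cs) (0\<^sub>m c d) (0\<^sub>m d c) (diag_block_mat Ds)"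
    unfolding diag_block_mat_append Let_def using C D by simp
  have AC: "diag_block_mat (A # Cs) = four_block_mat A (0\<^sub>m a c) (0\<^sub>m c a) (diag_block_mat Cs)"
    using A C by (simp add: Let_def)
  have CA: "diag_block_mat (Cs @ [A]) = four_block_mat (diag_block_mat Cs) (0\<^sub>m c a) (0\<^sub>m a c) A"
    using A C by (simp only: diag_block_mat_append Let_def diag_block_mat_singleton carrier_matD)
  have carr: "diag_block_mat (A # Cs) \<in> carrier_mat (a + c) (a + c)" "diag_block_mat (Cs @ Ds) \<in> carrier_mat (c + d) (c + d)"
    "diag_block_mat (Cs @ [A]) \<in> carrier_mat (c + a) (c + a)"
    unfolding AC CD CA using A C D by auto
  have As: "diag_block_mat As \<in> carrier_mat (c + d) (c + d)"
    using similar_matD[OF sim] carr(2) by auto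
  have "similar_mat (diag_block_mat (A # As)) (diag_block_mat (A # (Cs @ Ds)))"
  proof -
    have "diag_block_mat (A # As) = four_block_mat A (0\<^sub>m a (c + d)) (0\<^sub>m (c + d) a) (diag_block_mat As)"
      "diag_block_mat (A # (Cs @ Ds)) = four_block_mat A (0\<^sub>m a (c + d)) (0\<^sub>m (c + d) a) (diag_block_mat (Cs @ Ds))"
      using A As carr(2) by (simp_all add: Let_def)
    then show ?thesis
      using similar_mat_four_block_0_0[OF similar_mat_refl[OF A] sim A As] by simp
  qed
  moreover have "similar_mat (diag_block_mat ((A # Cs) @ Ds)) (diag_block_mat ((Cs @ [A]) @ Ds))"
  proof -
    have sw: "similar_mat (diag_block_mat (A # Cs)) (diag_block_mat (Cs @ [A]))"
      unfolding AC CA by (rule similar_mat_four_block_swap[OF A C])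
    have "diag_block_mat ((A # Cs) @ Ds) =
        four_block_mat (diag_block_mat (A # Cs)) (0\<^sub>m (a + c) d) (0\<^sub>m d (a + c)) (diag_block_mat Ds)"
      "diag_block_mat ((Cs @ [A]) @ Ds) =
        four_block_mat (diag_block_mat (Cs @ [A])) (0\<^sub>m (a + c) d) (0\<^sub>m d (a + c)) (diag_block_mat Ds)"
      using carr D by (simp_all only: diag_block_mat_append[of "A # Cs"] diag_block_mat_append[of "Cs @ [A]"] Let_def carrier_matD add.commute[of c a])
    then show ?thesis
      using similar_mat_four_block_0_0[OF sw similar_mat_refl[OF D] carr(1) D] by simp
  qed
  ultimately show ?case
    unfolding Bs using similar_mat_trans by fastforce
qed

lemma diag_block_mat_replicate_one:
  "diag_block_mat (replicate t (lower_jordan_block 1 b)) = b \<cdot>\<^sub>m 1\<^sub>m t"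
proof (induction t)
  case (Suc t)
  then show ?case
    by (intro eq_matI) (auto simp: Let_def lower_jordan_block_def)
qed (auto intro!: eq_matI)

text \<open>Scalar matrices are central, so conjugation fixes them. This matches
  \<open>Scalar_Type\<close>, which asks for equality where block types ask for similarity.\<close>

lemma similar_scalar_mat:
  fixes A :: "'a :: comm_ring_1 mat"
  assumes "similar_mat A (b \<cdot>\<^sub>m 1\<^sub>m n)"
  shows "A = b \<cdot>\<^sub>m 1\<^sub>m n"
proof -
  from similar_matD[OF assms] obtain m P G where carr: "A \<in> carrier_mat m m" "b \<cdot>\<^sub>m 1\<^sub>m n \<in> carrier_mat m m"
      "P \<in> carrier_mat m m" "G \<in> carrier_mat m m" and PG: "P * G = 1\<^sub>m m" and A: "A = P * (b \<cdot>\<^sub>m 1\<^sub>m n) * G"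
    by auto
  then have "m = n" by auto
  with carr have "P * (b \<cdot>\<^sub>m 1\<^sub>m n) = b \<cdot>\<^sub>m P"
    using mult_smult_distrib[of P n n "1\<^sub>m n" n b] by simp
  with A PG carr \<open>m = n\<close> show ?thesis
    by (simp add: mult_smult_assoc_mat[of _ n n])
qed

text \<open>This regroups an arbitrary list of block sizes into decreasing sizes with
  multiplicities, the ones being kept apart as the scalar part.\<close>

lemma mset_concat_replicate_count:
  assumes "finite S" "1 \<notin> S" "set ss \<subseteq> insert 1 S"
  shows "mset (concat (map (\<lambda>n. replicate (count (mset ss) n) n) (rev (sorted_list_of_set S))) @
    replicate (count (mset ss) 1) (1 :: nat)) = mset ss"
proof (rule multiset_eqI)
  fix x
  have "count (mset (concat (map (\<lambda>n. replicate (g n) n) ns))) x = (if x \<in> set ns then g x else 0)"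
    if "distinct ns" for ns and g :: "nat \<Rightarrow> nat"
    using that by (induction ns) auto
  note 1 = this[of "rev (sorted_list_of_set S)" "count (mset ss)"]
  have "count (mset ss) x = 0" if "x \<notin> S" "x \<noteq> 1"
    using assms(3) that by (auto simp: count_eq_zero_iff)
  with 1 assms(1,2) show "count (mset (concat (map (\<lambda>n. replicate (count (mset ss) n) n) (rev (sorted_list_of_set S))) @
      replicate (count (mset ss) 1) 1)) x = count (mset ss) x"
    by auto
qed

text \<open>The type is read off a Jordan normal form: distinct sizes other than 1 in decreasing
  order, their multiplicities, and the number of blocks of size 1. Permuting and reversing blocks
  stays within the similarity class.\<close>

lemma jordan_type_exists:
  assumes A: "A \<in> carrier_mat m m" and spec: "spec A = {complex_of_real a}"
  shows "\<exists>l \<in> jordan_types m. has_jordan_type A a l"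
proof -
  from jordan_nf_if_single_eigenvalue[OF assms] obtain ss where pos: "\<And>s. s \<in> set ss \<Longrightarrow> s > 0"
    and sum: "sum_list ss = m" and simJ: "similar_mat A (jordan_matrix (map (\<lambda>s. (s, a)) ss))"
    by auto
  let ?L = "\<lambda>s. lower_jordan_block s a"
  let ?c = "count (mset ss)"
  define ns where "ns = rev (sorted_list_of_set (set ss - {1}))"
  define ps where "ps = map ?c ns"
  define t where "t = ?c 1"
  define rs where "rs = concat (map (\<lambda>n. replicate (?c n) n) ns)"
  have mset: "mset (rs @ replicate t 1) = mset ss"
    unfolding rs_def ns_def t_def by (rule mset_concat_replicate_count) auto
  have "similar_mat (diag_block_mat (map (\<lambda>s. jordan_block s a) ss)) (diag_block_mat (map ?L ss))"
    using similar_diag_mat_block_mat[of "map (\<lambda>s. (jordan_block s a, ?L s)) ss"] similar_mat_sym[OF similar_lower_jordan_block]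
    by (auto simp: comp_def)
  moreover have "similar_mat (diag_block_mat (map ?L ss)) (diag_block_mat (map ?L (rs @ replicate t 1)))"
    by (rule similar_diag_block_mat_mset_eq) (use mset in \<open>auto simp only: mset_map set_map dim_lower_jordan_block square_mat.simps\<close>)
  moreover have "jordan_matrix (map (\<lambda>s. (s, a)) ss) = diag_block_mat (map (\<lambda>s. jordan_block s a) ss)"
    by (simp add: jordan_matrix_def comp_def)
  moreover have "diag_block_mat (map ?L (rs @ replicate t 1)) = diag_block_mat (map ?L rs @ [a \<cdot>\<^sub>m 1\<^sub>m t])"
    using diag_block_mat_append[of "map ?L rs" "replicate t (?L 1)"] diag_block_mat_append[of "map ?L rs" "[a \<cdot>\<^sub>m 1\<^sub>m t]"]
    by (simp only: map_append map_replicate diag_block_mat_replicate_one diag_block_mat_singleton)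
  ultimately have sim: "similar_mat A (diag_block_mat (map ?L rs @ [a \<cdot>\<^sub>m 1\<^sub>m t]))"
    using simJ similar_mat_trans by metis
  show ?thesis
  proof (cases "ns = []")
    \<comment> \<open>All blocks have size 1. A block type must list at least one size, so this case
      is the scalar symbol.\<close>
    case True
    then have "rs = []" by (simp add: rs_def)
    with sim have "A = a \<cdot>\<^sub>m 1\<^sub>m t"
      by (intro similar_scalar_mat) (simp del: diag_block_mat.simps)
    moreover from this A have "t = m" by auto
    ultimately show ?thesis
      by (intro bexI[of _ "Scalar_Type m"]) (auto simp: jordan_types_def)
  next
    case False
    have "concat (map2 (\<lambda>n p. replicate p (?L n)) xs (map g xs)) = map ?L (concat (map (\<lambda>n. replicate (g n) n) xs))"
      for xs and g :: "nat \<Rightarrow> nat"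
      by (induction xs) auto
    from this[of ns ?c] sim have "has_jordan_type A a (Block_Type ns ps t)"
      by (simp add: ps_def rs_def)
    moreover have "is_jordan_type m (Block_Type ns ps t)"
    proof -
      have "sum_list (concat (map (\<lambda>n. replicate (g n) n) xs)) = (\<Sum>i<length xs. xs ! i * map g xs ! i)"
        for xs and g :: "nat \<Rightarrow> nat"
        by (induction xs) (simp_all add: sum_list_replicate sum.lessThan_Suc_shift del: sum.lessThan_Suc)
      from this[of ?c ns] have "(\<Sum>i<length ns. ns ! i * ps ! i) + t = sum_list (rs @ replicate t 1)"
        by (simp add: ps_def rs_def sum_list_replicate)
      also have "\<dots> = m"
        using arg_cong[OF mset, of sum_mset] by (simp only: sum_mset_sum_list sum)
      finally have "(\<Sum>i<length ns. ns ! i * ps ! i) + t = m" .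
      moreover have "sorted_wrt (>) ns"
        unfolding ns_def sorted_wrt_rev by (rule strict_sorted_list_of_set)
      moreover have "n \<ge> 2 \<and> ?c n > 0" if "n \<in> set ns" for n
        using pos[of n] that by (auto simp: ns_def)
      ultimately show ?thesis
        using False by (auto simp: ps_def Suc_le_eq)
    qed
    ultimately show ?thesis
      by (auto simp: jordan_types_def simp del: is_jordan_type.simps has_jordan_type.simps)
  qed
qed

text \<open>The eigenvalue quantified in the definition is pinned to \<open>a\<close> by the
  spectrum.\<close>

lemma jordan_type_of:
  assumes A: "A \<in> carrier_mat m m" and spec: "spec A = {complex_of_real a}"
  shows "is_jordan_type m (jordan_type_of A)" "has_jordan_type A a (jordan_type_of A)"
proof -
  have "\<exists>l. l \<in> jordan_types (dim_row A) \<and> (\<exists>b. spec A = {complex_of_real b} \<and> has_jordan_type A b l)"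
    using jordan_type_exists[OF assms] A spec by auto
  from someI_ex[OF this] show "is_jordan_type m (jordan_type_of A)" "has_jordan_type A a (jordan_type_of A)"
    unfolding jordan_type_of_def using A spec by (auto simp: jordan_types_def)
qed

section \<open>The complementary summand\<close>

lemma invertible_char_matrix_pow:
  assumes Q: "Q \<in> carrier_mat m m" and "complex_of_real a \<notin> spec Q"
  shows "\<exists>R \<in> carrier_mat m m. R * (char_matrix Q a ^\<^sub>m i) = 1\<^sub>m m \<and> (char_matrix Q a ^\<^sub>m i) * R = 1\<^sub>m m"
proof -
  have "poly (char_poly (map_mat complex_of_real Q)) (of_real a) \<noteq> 0"
    using assms by (auto simp: spec_def spectrum_root_char_poly[of _ m])
  then have "poly (char_poly Q) a \<noteq> 0"
    using poly_char_poly_of_real[OF Q] by simp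
  then have "det (char_matrix Q a) \<noteq> 0"
    using eigenvalue_root_char_poly[OF Q] eigenvalue_det[OF Q] by simp
  then have "det (char_matrix Q a ^\<^sub>m i) \<noteq> 0"
  proof (induction i)
    case (Suc i)
    with Q show ?case by (simp add: det_mult[of _ m])
  qed (use Q in simp)
  from det_non_zero_imp_unit[OF pow_carrier_mat[OF char_matrix_closed[OF Q]] this, unfolded Units_def, of "()"]
  show ?thesis by (auto simp: ring_mat_def)
qed

lemma dim_gen_eigenspace_not_eigenvalue:
  assumes "Q \<in> carrier_mat m m" "complex_of_real a \<notin> spec Q"
  shows "dim_gen_eigenspace Q a i = 0"
  using invertible_char_matrix_pow[OF assms, of i] assms(1)
  unfolding dim_gen_eigenspace_def by (auto intro: kernel_dim_zero_if_inverse[of _ m])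

text \<open>
  With \<open>C\<close> the \<open>p\<close>-th power of \<open>four_block_mat A 0 0 Q - a\<close>, the second summand is the range of \<open>C\<close>;
  as the hyperplane belongs to the eigenvalue \<open>a\<close>, it contains this range, which the complex
  structure of the hyperplane leaves invariant.
\<close>

lemma complexifiable_complement:
  assumes A: "A \<in> carrier_mat p p" and nilpotent: "char_matrix A a ^\<^sub>m p = 0\<^sub>m p p" and "p > 0"
    and Q: "Q \<in> carrier_mat m m" "complex_of_real a \<notin> spec Q"
    and dim: "p + m = Suc k"
    and v: "v \<in> carrier_vec k" and "complexifiable k B"
    and sim: "similar_mat (four_block_mat A (0\<^sub>m p m) (0\<^sub>m m p) Q) (bordered_mat a v B)"
  shows "complexifiable m Q"
proof -
  from assms(8) obtain J where B: "B \<in> carrier_mat k k" and J: "J \<in> carrier_mat k k" "J * J = - 1\<^sub>m k" "B * J = J * B"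
    unfolding complexifiable_def by auto
  let ?M = "four_block_mat A (0\<^sub>m p m) (0\<^sub>m m p) Q"
  have M: "?M \<in> carrier_mat (Suc k) (Suc k)"
    using A Q dim four_block_carrier_mat by metis
  from sim obtain P G where wit: "similar_mat_wit ?M (bordered_mat a v B) P G"
    unfolding similar_mat_def by auto
  note PG = similar_mat_witD2[OF M wit]
  \<comment> \<open>The \<open>p\<close>-th power annihilates the first summand and acts by the
    invertible \<open>R\<close> on the second, so its range is exactly the second summand.\<close>
  define R where "R = char_matrix Q a ^\<^sub>m p"
  have R: "R \<in> carrier_mat m m" using Q by (simp add: R_def)
  from invertible_char_matrix_pow[OF Q, of p] obtain R' where R': "R' \<in> carrier_mat m m" "R * R' = 1\<^sub>m m"
    unfolding R_def by auto
  define Bp where "Bp = char_matrix B a ^\<^sub>m p"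
  have Bp: "Bp \<in> carrier_mat k k" using B by (simp add: Bp_def)
  have BpJ: "Bp * J = J * Bp"
    unfolding Bp_def using pow_char_matrix_commute[OF B J(1,3)] .
  \<comment> \<open>The quotient eigenvalue is \<open>a\<close> and p > 0, so the corner entry of
    the power is 0: its range lies in the hyperplane.\<close>
  obtain v' where v': "v' \<in> carrier_vec k" and pow: "char_matrix (bordered_mat a v B) a ^\<^sub>m p = bordered_mat 0 v' Bp"
    using pow_bordered_mat[OF v, of "char_matrix B a" "a - a" p] B v \<open>p > 0\<close>
    by (auto simp: char_matrix_bordered_mat Bp_def zero_power)
  have "char_matrix ?M a ^\<^sub>m p = four_block_mat (0\<^sub>m p p) (0\<^sub>m p m) (0\<^sub>m m p) R"
    using A Q by (simp add: char_matrix_four_block pow_four_block_mat[of _ p _ m] nilpotent R_def)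
  with similar_mat_wit_pow[OF similar_mat_wit_char_matrix[OF wit, of a], of p] pow
  have wit': "similar_mat_wit (four_block_mat (0\<^sub>m p p) (0\<^sub>m p m) (0\<^sub>m m p) R) (bordered_mat 0 v' Bp) P G"
    by simp
  have conj: "G *\<^sub>v (X *\<^sub>v x) = Y *\<^sub>v (G *\<^sub>v x)" if "similar_mat_wit X Y P G" "X \<in> carrier_mat (Suc k) (Suc k)"
    "x \<in> carrier_vec (Suc k)" for X Y x
  proof -
    note w = similar_mat_witD2[OF that(2,1)]
    have "G * X = Y * G"
      using similar_mat_witD2(3)[OF w(5) similar_mat_wit_sym[OF that(1)]] w(1,2,4-)
      by (simp add: assoc_mult_mat[of _ "Suc k" "Suc k" _ "Suc k" _ "Suc k"])
    then show ?thesis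
      using assoc_mult_mat_vec[OF w(7) that(2,3)] assoc_mult_mat_vec[OF w(5,7) that(3)] by simp
  qed
  \<comment> \<open>\<open>F\<close> embeds the second summand into the basis adapted to the
    hyperplane.\<close>
  define F where "F y = G *\<^sub>v (0\<^sub>v p @\<^sub>v y)" for y
  have emb: "0\<^sub>v p @\<^sub>v y \<in> carrier_vec (Suc k)" if "y \<in> carrier_vec m" for y :: "real vec"
    unfolding dim[symmetric] using that by simp
  have F: "F y \<in> carrier_vec (Suc k)" if "y \<in> carrier_vec m" for y
    unfolding F_def using PG(7) emb[OF that] by (rule mult_mat_vec_carrier)
  have block: "four_block_mat X (0\<^sub>m p m) (0\<^sub>m m p) Y *\<^sub>v (x @\<^sub>v y) = (X *\<^sub>v x) @\<^sub>v (Y *\<^sub>v y)"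
    if "X \<in> carrier_mat p p" "Y \<in> carrier_mat m m" "x \<in> carrier_vec p" "y \<in> carrier_vec m" for X Y and x y :: "real vec"
    using that by (rule mult_mat_vec_split)
  have FQ: "F (Q *\<^sub>v y) = bordered_mat a v B *\<^sub>v F y" if "y \<in> carrier_vec m" for y
    using conj[OF wit M emb[OF that]] block[OF A Q(1) zero_carrier_vec that] A by (simp add: F_def)
  have carr_R: "four_block_mat (0\<^sub>m p p) (0\<^sub>m p m) (0\<^sub>m m p) R \<in> carrier_mat (Suc k) (Suc k)"
    using R dim four_block_carrier_mat zero_carrier_mat by metis
  have FR: "F (R *\<^sub>v y) = bordered_mat 0 v' Bp *\<^sub>v (G *\<^sub>v (x @\<^sub>v y))"
    if "y \<in> carrier_vec m" "x \<in> carrier_vec p" for x y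
  proof -
    have "x @\<^sub>v y \<in> carrier_vec (Suc k)" unfolding dim[symmetric] using that by simp
    from conj[OF wit' carr_R this] block[OF zero_carrier_mat R that(2,1)] that show ?thesis
      by (simp add: F_def)
  qed
  have RR': "R *\<^sub>v (R' *\<^sub>v y) = y" if "y \<in> carrier_vec m" for y
    using assoc_mult_mat_vec[OF R R'(1) that] that by (simp add: R'(2))
  have R'c: "R' *\<^sub>v y \<in> carrier_vec m" if "y \<in> carrier_vec m" for y
    using R'(1) that by (rule mult_mat_vec_carrier)
  \<comment> \<open>Writing y = R (R' y) places F y in the range of the power, hence in the
    hyperplane; \<open>S\<close> below is \<open>F\<close> without its zero first
    coordinate.\<close>
  have F0: "F y = vCons 0 (vec_last (F y) k)" and Fc: "vec_last (F y) k \<in> carrier_vec k" if y: "y \<in> carrier_vec m" for y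
  proof -
    obtain s w where sw: "w \<in> carrier_vec k" "F (R' *\<^sub>v y) = vCons s w"
      using F[OF R'c[OF y]] by (metis carrier_vec_SucE)
    have "F y = bordered_mat 0 v' Bp *\<^sub>v F (R' *\<^sub>v y)"
      using FR[OF R'c[OF y] zero_carrier_vec] by (simp add: RR'[OF y] F_def)
    also have "\<dots> = vCons 0 (s \<cdot>\<^sub>v v' + Bp *\<^sub>v w)"
      using sw v' Bp by (simp add: bordered_mat_mult_vCons)
    finally have Fy: "F y = vCons 0 (s \<cdot>\<^sub>v v' + Bp *\<^sub>v w)" .
    have "s \<cdot>\<^sub>v v' + Bp *\<^sub>v w \<in> carrier_vec k"
      using sw v' mult_mat_vec_carrier[OF Bp sw(1)] by simp
    from vec_last_vCons[OF this, of 0] Fy show "F y = vCons 0 (vec_last (F y) k)" by simp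
    show "vec_last (F y) k \<in> carrier_vec k" by simp
  qed
  have emb_add: "0\<^sub>v p @\<^sub>v (x + y) = (0\<^sub>v p @\<^sub>v x) + (0\<^sub>v p @\<^sub>v y)" if "x \<in> carrier_vec m" "y \<in> carrier_vec m" for x y :: "real vec"
    using that by (intro eq_vecI) auto
  have emb_smult: "0\<^sub>v p @\<^sub>v (c \<cdot>\<^sub>v x) = c \<cdot>\<^sub>v (0\<^sub>v p @\<^sub>v x)" if "x \<in> carrier_vec m" for c and x :: "real vec"
    using that by (intro eq_vecI) auto
  have "\<exists>S \<in> carrier_mat k m. \<forall>y \<in> carrier_vec m. vec_last (F y) k = S *\<^sub>v y"
  proof (rule linear_map_eq_mult_mat_vec)
    fix x y :: "real vec" assume xy: "x \<in> carrier_vec m" "y \<in> carrier_vec m"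
    have "F (x + y) = F x + F y"
      unfolding F_def emb_add[OF xy] using PG(7) emb xy by (intro mult_add_distrib_mat_vec) auto
    with F[OF xy(1)] F[OF xy(2)] show "vec_last (F (x + y)) k = vec_last (F x) k + vec_last (F y) k"
      by (intro eq_vecI) (auto simp: vec_last_def)
  next
    fix c and x :: "real vec" assume x: "x \<in> carrier_vec m"
    have "F (c \<cdot>\<^sub>v x) = c \<cdot>\<^sub>v F x"
      unfolding F_def emb_smult[OF x] using PG(7) emb x by (intro mult_mat_vec) auto
    with F[OF x] show "vec_last (F (c \<cdot>\<^sub>v x)) k = c \<cdot>\<^sub>v vec_last (F x) k"
      by (intro eq_vecI) (auto simp: vec_last_def)
  qed (rule Fc)
  then obtain S where S: "S \<in> carrier_mat k m" "\<And>y. y \<in> carrier_vec m \<Longrightarrow> vec_last (F y) k = S *\<^sub>v y"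
    by auto
  have FS: "F y = vCons 0 (S *\<^sub>v y)" if "y \<in> carrier_vec m" for y
    using F0[OF that] S(2)[OF that] by simp
  have Sc: "S *\<^sub>v y \<in> carrier_vec k" if "y \<in> carrier_vec m" for y
    using S(1) that by (rule mult_mat_vec_carrier)
  have Qc: "Q *\<^sub>v y \<in> carrier_vec m" if "y \<in> carrier_vec m" for y
    using Q(1) that by (rule mult_mat_vec_carrier)
  have "B * S = S * Q"
  proof (rule mat_eq_by_mult_vec)
    fix y :: "real vec" assume y: "y \<in> carrier_vec m"
    have "vCons 0 (S *\<^sub>v (Q *\<^sub>v y)) = vCons 0 (B *\<^sub>v (S *\<^sub>v y))"
      using FQ[OF y] FS[OF y] FS[OF Qc[OF y]] v B Sc[OF y] mult_mat_vec_carrier[OF B Sc[OF y]]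
      by (simp add: bordered_mat_mult_vCons)
    then show "B * S *\<^sub>v y = S * Q *\<^sub>v y"
      using assoc_mult_mat_vec[OF B S(1) y] assoc_mult_mat_vec[OF S(1) Q(1) y] by simp
  qed (use B S Q in auto)
  moreover have "c = 0\<^sub>v m" if c: "c \<in> carrier_vec m" "S *\<^sub>v c = 0\<^sub>v k" for c
  proof -
    have "F c = 0\<^sub>v (Suc k)"
      using FS[OF c(1)] c(2) by (simp add: zero_vec_Suc)
    then have "P * G *\<^sub>v (0\<^sub>v p @\<^sub>v c) = 0\<^sub>v (Suc k)"
      using assoc_mult_mat_vec[OF PG(6,7) emb[OF c(1)]] PG(6) by (simp add: F_def)
    with emb[OF c(1)] have 0: "0\<^sub>v p @\<^sub>v c = 0\<^sub>v (Suc k)" by (simp add: PG(1))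
    have "c $ i = 0" if "i < m" for i
      using arg_cong[OF 0, of "\<lambda>x. x $ (p + i)"] that c(1) dim by simp
    with c(1) show ?thesis by (intro eq_vecI) auto
  qed
  moreover have "\<exists>c' \<in> carrier_vec m. J *\<^sub>v (S *\<^sub>v y) = S *\<^sub>v c'" if y: "y \<in> carrier_vec m" for y
  proof -
    \<comment> \<open>The power maps the whole space into the second summand, so in particular its
      restriction \<open>Bp\<close> to the hyperplane has range inside the image of
      \<open>S\<close>.\<close>
    have range: "\<exists>c \<in> carrier_vec m. Bp *\<^sub>v z = S *\<^sub>v c" if z: "z \<in> carrier_vec k" for z
    proof -
      define x where "x = P *\<^sub>v vCons 0 z"
      have x: "x \<in> carrier_vec (p + m)"
        unfolding x_def dim using PG(6) z by (auto intro: mult_mat_vec_carrier)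
      then have split: "vec_first x p @\<^sub>v vec_last x m = x" by simp
      have Gx: "G *\<^sub>v x = vCons 0 z"
        using assoc_mult_mat_vec[OF PG(7,6), of "vCons 0 z"] z by (simp add: x_def PG(2))
      have c: "R *\<^sub>v vec_last x m \<in> carrier_vec m"
        using R by (auto intro: mult_mat_vec_carrier)
      have "F (R *\<^sub>v vec_last x m) = vCons 0 (Bp *\<^sub>v z)"
        using FR[of "vec_last x m" "vec_first x p"] v' Bp z mult_mat_vec_carrier[OF Bp z]
        by (simp add: split Gx bordered_mat_mult_vCons)
      with FS[OF c] c show ?thesis by auto
    qed
    \<comment> \<open>Every vector of the summand is already a value of \<open>Bp\<close>. As
      \<open>J\<close> commutes with \<open>Bp\<close>, its image under \<open>J\<close> is again
      such a value and so lies in the summand.\<close>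
    have "vCons 0 (S *\<^sub>v y) = bordered_mat 0 v' Bp *\<^sub>v F (R' *\<^sub>v y)"
      using FR[OF R'c[OF y] zero_carrier_vec] FS[OF y] by (simp add: RR'[OF y] F_def)
    also have "\<dots> = vCons 0 (Bp *\<^sub>v (S *\<^sub>v (R' *\<^sub>v y)))"
      using FS[OF R'c[OF y]] v' Bp Sc[OF R'c[OF y]] mult_mat_vec_carrier[OF Bp Sc[OF R'c[OF y]]]
      by (simp add: bordered_mat_mult_vCons)
    finally have "S *\<^sub>v y = Bp *\<^sub>v (S *\<^sub>v (R' *\<^sub>v y))" by simp
    then have "J *\<^sub>v (S *\<^sub>v y) = Bp *\<^sub>v (J *\<^sub>v (S *\<^sub>v (R' *\<^sub>v y)))"
      using assoc_mult_mat_vec[OF J(1) Bp Sc[OF R'c[OF y]]] assoc_mult_mat_vec[OF Bp J(1) Sc[OF R'c[OF y]]]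
      by (simp add: BpJ)
    moreover have "J *\<^sub>v (S *\<^sub>v (R' *\<^sub>v y)) \<in> carrier_vec k"
      using J(1) Sc[OF R'c[OF y]] by (rule mult_mat_vec_carrier)
    ultimately show ?thesis using range by metis
  qed
  ultimately show ?thesis
    by (intro complexifiable_restrict[OF B J S(1) Q(1)])
qed

theorem theorem4p17:
  fixes M Ma Q :: "real mat" and a :: real and n m\<^sub>a m :: nat
  assumes "M \<in> carrier_mat (2 * n - 1) (2 * n - 1)"
    and "M = diag_block_mat [Ma, Q]"
    and "Ma \<in> carrier_mat m\<^sub>a m\<^sub>a"
    and "spec Ma = {complex_of_real a}"
    and "odd m\<^sub>a"
    and "Q \<in> carrier_mat m m"
    and "m = 2 * n - 1 - m\<^sub>a"
    and "m \<ge> 1"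
    and "complex_of_real a \<notin> spec Q"
  shows "admits_complex_structure (2 * n) (semidirect_bracket M) \<longleftrightarrow>
    jordan_type_of Ma \<in> complex_jordan_types m\<^sub>a \<and>
    (\<exists>J' \<in> carrier_mat m m. J' * J' = - 1\<^sub>m m \<and> Q \<in> commutant J' m)"
proof -
  note Ma = assms(3) and Q = assms(6)
  from \<open>odd m\<^sub>a\<close> obtain k where k: "m\<^sub>a = Suc k" "even k" by (cases m\<^sub>a) auto
  \<comment> \<open>As m is positive, the natural number subtractions defining it are not
    truncated.\<close>
  have dim: "m\<^sub>a + m = Suc (k + m)" "2 * n = Suc (Suc (k + m))" using assms(7,8) k(1) by linarith+
  have M: "M = four_block_mat Ma (0\<^sub>m m\<^sub>a m) (0\<^sub>m m m\<^sub>a) Q"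
    using Ma Q by (simp only: assms(2) diag_block_mat_pair carrier_matD)
  have Mc: "M \<in> carrier_mat (Suc (k + m)) (Suc (k + m))"
    unfolding M dim(1)[symmetric] using Ma Q by simp
  note type = jordan_type_of[OF Ma assms(4)]
  have "admits_complex_structure (2 * n) (semidirect_bracket M) \<longleftrightarrow> hyperplane_complexifiable (k + m) M"
    unfolding dim(2)
    using admits_complex_structure_if_hyperplane_complexifiable[OF Mc]
      hyperplane_complexifiable_if_admits_complex_structure[OF Mc] by blast
  also have "\<dots> \<longleftrightarrow> is_complex_type (jordan_type_of Ma) \<and> complexifiable m Q"
  proof
    assume "hyperplane_complexifiable (k + m) M"
    then obtain c v B where v: "v \<in> carrier_vec (k + m)" and B: "complexifiable (k + m) B"
      and sim: "similar_mat M (bordered_mat c v B)"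
      unfolding hyperplane_complexifiable_def by blast
    \<comment> \<open>The summand \<open>Q\<close> has no generalized eigenvectors for
      \<open>a\<close>, so the bordered form of \<open>M\<close> carries the dimensions of
      \<open>Ma\<close> alone.\<close>
    have dims: "dim_gen_eigenspace (bordered_mat c v B) a i = dim_gen_eigenspace Ma a i" for i
      using dim_gen_eigenspace_four_block[OF Ma Q, of a i] dim_gen_eigenspace_not_eigenvalue[OF Q assms(9)]
      by (simp add: dim_gen_eigenspace_similar[OF sim, symmetric] M)
    note parity = dim_gen_eigenspace_bordered_mat[OF v B, of c a, unfolded dims]
    obtain K where K: "odd (dim_gen_eigenspace Ma a K)"
      using ex_odd_dim_gen_eigenspace[OF type(1) assms(5) type(2)] by blast
    have "is_complex_type (jordan_type_of Ma)"
    proof (cases "jordan_type_of Ma")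
      case (Block_Type ns ps t)
      with type have len: "length ps = length ns" by simp
      note f = dim_gen_eigenspace_jordan_type[OF len type(2)[unfolded Block_Type]]
      show ?thesis
        unfolding Block_Type
        using complex_type_if_odd_upward_closed[OF type(1)[unfolded Block_Type], folded f] parity(2) K by blast
    qed simp
    \<comment> \<open>The odd dimension found at \<open>K\<close> also identifies the quotient
      eigenvalue \<open>c\<close> with \<open>a\<close>, which places the second summand inside the
      hyperplane.\<close>
    moreover have "complexifiable m Q"
      using complexifiable_complement[OF Ma nilpotent_if_single_eigenvalue[OF Ma assms(4)] _ Q assms(9) dim(1) v B]
        sim k parity(1)[OF K] M by simp
    ultimately show "is_complex_type (jordan_type_of Ma) \<and> complexifiable m Q" ..
  next
    assume "is_complex_type (jordan_type_of Ma) \<and> complexifiable m Q"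
    then have "hyperplane_complexifiable k Ma" "complexifiable m Q"
      using hyperplane_complexifiable_if_complex_type[of k] type Ma k by auto
    then show "hyperplane_complexifiable (k + m) M"
      using hyperplane_complexifiable_four_block Ma unfolding M k(1) by blast
  qed
  finally show ?thesis
    using type(1) Q by (auto simp: complex_jordan_types_def jordan_types_def complexifiable_def commutant_def)
qed

end
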